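(* Let $F$ be a field with at least three elements, and let $R$ be an $F$-algebra. If $R$ is generalized $t$-fine, then $\mathbb{M}_n(R)$ is also generalized $t$-fine for every positive integer $n$.
   Context: Rings and algebras are associative with identity $1$ (not necessarily commutative). For a ring $R$: $\mathrm{J}(R)$ is the Jacobson radical, $\mathrm{Nil}(R)$ the set of nilpotent elements, and $\mathcal{T}(R)$ the set of torsion units, i.e. units $u$ with $u^m=1$ for some $m\ge 1$. $R$ is generalized $t$-fine if $R\setminus \mathrm{J}(R)=\mathcal{T}(R)+\mathrm{Nil}(R)$. $\mathbb{M}_n(R)$ is the ring of $n\times n$ matrices over $R$. *)

theory Defs
  imports "HOL-Algebra.Module" "HOL-Algebra.AbelCoset" "Jordan_Normal_Form.Matrix"
begin

text \<open>
  The locale \<^locale>\<open>algebra\<close> requires the algebra to be commutative; here it need not be, so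
  compatibility of the scalars with multiplication is required on both sides.
\<close>

locale assoc_algebra = module F A + ring A for F and A (structure) +
  assumes smult_mult_left:
      "\<lbrakk>a \<in> carrier F; x \<in> carrier A; y \<in> carrier A\<rbrakk> \<Longrightarrow> (a \<odot> x) \<otimes> y = a \<odot> (x \<otimes> y)"
    and smult_mult_right:
      "\<lbrakk>a \<in> carrier F; x \<in> carrier A; y \<in> carrier A\<rbrakk> \<Longrightarrow> x \<otimes> (a \<odot> y) = a \<odot> (x \<otimes> y)"

locale left_ideal = additive_subgroup I R + ring R for I and R (structure) +
  assumes I_l_closed: "\<lbrakk>a \<in> I; x \<in> carrier R\<rbrakk> \<Longrightarrow> x \<otimes> a \<in> I"

locale maximal_left_ideal = left_ideal +
  assumes I_notcarr: "I \<noteq> carrier R"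
    and I_maximal: "\<lbrakk>left_ideal J R; I \<subseteq> J\<rbrakk> \<Longrightarrow> J = I \<or> J = carrier R"

text \<open>The intersection is taken inside \<^term>\<open>carrier R\<close>, so that the radical of the zero ring is
  the zero ring.\<close>

definition jacobson_radical :: "('a, 'b) ring_scheme \<Rightarrow> 'a set"
  where "jacobson_radical R = {x \<in> carrier R. \<forall>I. maximal_left_ideal I R \<longrightarrow> x \<in> I}"

definition nilpotents :: "('a, 'b) ring_scheme \<Rightarrow> 'a set"
  where "nilpotents R = {x \<in> carrier R. \<exists>k::nat. 1 \<le> k \<and> x [^]\<^bsub>R\<^esub> k = \<zero>\<^bsub>R\<^esub>}"

definition torsion_units :: "('a, 'b) ring_scheme \<Rightarrow> 'a set"
  where "torsion_units R = {u \<in> Units R. \<exists>m::nat. 1 \<le> m \<and> u [^]\<^bsub>R\<^esub> m = \<one>\<^bsub>R\<^esub>}"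

locale generalized_t_fine = ring R for R (structure) +
  assumes sum_decomposition:
    "carrier R - jacobson_radical R = torsion_units R <+>\<^bsub>R\<^esub> nilpotents R"

text \<open>
  \<^const>\<open>ring_mat\<close> takes its entries from a type class; here the entries come from a ring given
  by a carrier. Row and column indices range over \<open>0, \<dots>, n - 1\<close>.
\<close>

definition matrix_ring :: "nat \<Rightarrow> ('a, 'b) ring_scheme \<Rightarrow> 'a mat ring"
  where "matrix_ring n R =
    \<lparr>carrier = {A \<in> carrier_mat n n. \<forall>i<n. \<forall>j<n. A $$ (i, j) \<in> carrier R},
     monoid.mult = (\<lambda>A B. mat n n (\<lambda>(i, j). \<Oplus>\<^bsub>R\<^esub>k\<in>{..<n}. A $$ (i, k) \<otimes>\<^bsub>R\<^esub> B $$ (k, j))),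
     one = mat n n (\<lambda>(i, j). if i = j then \<one>\<^bsub>R\<^esub> else \<zero>\<^bsub>R\<^esub>),
     zero = mat n n (\<lambda>(i, j). \<zero>\<^bsub>R\<^esub>),
     add = (\<lambda>A B. mat n n (\<lambda>(i, j). A $$ (i, j) \<oplus>\<^bsub>R\<^esub> B $$ (i, j)))\<rparr>"

lemma (in abelian_monoid) finsum_swap:
  assumes "finite X" "finite Y" "\<And>x y. x \<in> X \<Longrightarrow> y \<in> Y \<Longrightarrow> f x y \<in> carrier G"
  shows "(\<Oplus>x\<in>X. \<Oplus>y\<in>Y. f x y) = (\<Oplus>y\<in>Y. \<Oplus>x\<in>X. f x y)"
  using assms(1,3)
proof (induction X rule: finite_induct)
  case empty
  then show ?case by simp
next
  case (insert a X)
  have "(\<Oplus>x\<in>insert a X. \<Oplus>y\<in>Y. f x y) = (\<Oplus>y\<in>Y. f a y) \<oplus> (\<Oplus>x\<in>X. \<Oplus>y\<in>Y. f x y)"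
    using insert by (intro finsum_insert) (auto intro!: finsum_closed)
  also have "\<dots> = (\<Oplus>y\<in>Y. f a y) \<oplus> (\<Oplus>y\<in>Y. \<Oplus>x\<in>X. f x y)"
    using insert by simp
  also have "\<dots> = (\<Oplus>y\<in>Y. f a y \<oplus> (\<Oplus>x\<in>X. f x y))"
    using insert by (intro finsum_addf[symmetric]) (auto intro!: finsum_closed)
  also have "\<dots> = (\<Oplus>y\<in>Y. \<Oplus>x\<in>insert a X. f x y)"
    using insert by (intro finsum_cong' refl finsum_insert[symmetric]) (auto intro!: finsum_closed)
  finally show ?case .
qed

lemma (in ring) matrix_ring_is_ring: "ring (matrix_ring n R)"
proof (rule ringI)
  let ?M = "matrix_ring n R"
  show "abelian_group ?M"
  proof (rule abelian_groupI)
    fix A assume A: "A \<in> carrier ?M"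
    show "\<exists>B\<in>carrier ?M. B \<oplus>\<^bsub>?M\<^esub> A = \<zero>\<^bsub>?M\<^esub>"
      using A by (intro bexI[of _ "mat n n (\<lambda>ij. \<ominus> (A $$ ij))"])
        (auto simp: matrix_ring_def l_neg)
  qed (auto simp: matrix_ring_def a_ac)
  show "monoid ?M"
  proof (rule monoidI)
    fix A B C assume "A \<in> carrier ?M" "B \<in> carrier ?M" "C \<in> carrier ?M"
    then have cl: "\<And>i j. i < n \<Longrightarrow> j < n \<Longrightarrow> A $$ (i, j) \<in> carrier R"
        "\<And>i j. i < n \<Longrightarrow> j < n \<Longrightarrow> B $$ (i, j) \<in> carrier R"
        "\<And>i j. i < n \<Longrightarrow> j < n \<Longrightarrow> C $$ (i, j) \<in> carrier R"
      by (auto simp: matrix_ring_def)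
    have "(\<Oplus>l\<in>{..<n}. (\<Oplus>k\<in>{..<n}. A $$ (i, k) \<otimes> B $$ (k, l)) \<otimes> C $$ (l, j))
        = (\<Oplus>k\<in>{..<n}. A $$ (i, k) \<otimes> (\<Oplus>l\<in>{..<n}. B $$ (k, l) \<otimes> C $$ (l, j)))"
      if "i < n" "j < n" for i j
    proof -
      have "(\<Oplus>l\<in>{..<n}. (\<Oplus>k\<in>{..<n}. A $$ (i, k) \<otimes> B $$ (k, l)) \<otimes> C $$ (l, j))
          = (\<Oplus>l\<in>{..<n}. \<Oplus>k\<in>{..<n}. A $$ (i, k) \<otimes> B $$ (k, l) \<otimes> C $$ (l, j))"
        using cl that by (intro finsum_cong' refl finsum_ldistr) (auto intro!: finsum_closed)
      also have "\<dots> = (\<Oplus>k\<in>{..<n}. \<Oplus>l\<in>{..<n}. A $$ (i, k) \<otimes> B $$ (k, l) \<otimes> C $$ (l, j))"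
        using cl that by (intro finsum_swap) auto
      also have "\<dots> = (\<Oplus>k\<in>{..<n}. A $$ (i, k) \<otimes> (\<Oplus>l\<in>{..<n}. B $$ (k, l) \<otimes> C $$ (l, j)))"
        using cl that
        by (intro finsum_cong' refl)
          (auto intro!: finsum_closed finsum_cong' simp: finsum_rdistr m_assoc Pi_def)
      finally show ?thesis .
    qed
    then show "A \<otimes>\<^bsub>?M\<^esub> B \<otimes>\<^bsub>?M\<^esub> C = A \<otimes>\<^bsub>?M\<^esub> (B \<otimes>\<^bsub>?M\<^esub> C)"
      using cl by (auto simp: matrix_ring_def intro!: eq_matI cong: finsum_cong)
  next
    fix A assume A: "A \<in> carrier ?M"
    then have cl: "\<And>i j. i < n \<Longrightarrow> j < n \<Longrightarrow> A $$ (i, j) \<in> carrier R"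
      by (auto simp: matrix_ring_def)
    have "(\<Oplus>k\<in>{..<n}. (if i = k then \<one> else \<zero>) \<otimes> A $$ (k, j)) = A $$ (i, j)"
      if "i < n" "j < n" for i j
    proof -
      have "(\<Oplus>k\<in>{..<n}. (if i = k then \<one> else \<zero>) \<otimes> A $$ (k, j))
          = (\<Oplus>k\<in>{..<n}. if i = k then A $$ (k, j) else \<zero>)"
        using cl that by (intro finsum_cong') auto
      also have "\<dots> = A $$ (i, j)"
        using cl that by (intro add.finprod_singleton) auto
      finally show ?thesis .
    qed
    then show "\<one>\<^bsub>?M\<^esub> \<otimes>\<^bsub>?M\<^esub> A = A"
      using A by (auto simp: matrix_ring_def intro!: eq_matI cong: finsum_cong)
    have "(\<Oplus>k\<in>{..<n}. A $$ (i, k) \<otimes> (if k = j then \<one> else \<zero>)) = A $$ (i, j)"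
      if "i < n" "j < n" for i j
    proof -
      have "(\<Oplus>k\<in>{..<n}. A $$ (i, k) \<otimes> (if k = j then \<one> else \<zero>))
          = (\<Oplus>k\<in>{..<n}. if j = k then A $$ (i, k) else \<zero>)"
        using cl that by (intro finsum_cong') auto
      also have "\<dots> = A $$ (i, j)"
        using cl that by (intro add.finprod_singleton) auto
      finally show ?thesis .
    qed
    then show "A \<otimes>\<^bsub>?M\<^esub> \<one>\<^bsub>?M\<^esub> = A"
      using A by (auto simp: matrix_ring_def intro!: eq_matI cong: finsum_cong)
  qed (auto simp: matrix_ring_def intro!: finsum_closed)
  fix A B C assume "A \<in> carrier ?M" "B \<in> carrier ?M" "C \<in> carrier ?M"
  then have cl: "\<And>i j. i < n \<Longrightarrow> j < n \<Longrightarrow> A $$ (i, j) \<in> carrier R"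
      "\<And>i j. i < n \<Longrightarrow> j < n \<Longrightarrow> B $$ (i, j) \<in> carrier R"
      "\<And>i j. i < n \<Longrightarrow> j < n \<Longrightarrow> C $$ (i, j) \<in> carrier R"
    by (auto simp: matrix_ring_def)
  have "(\<Oplus>k\<in>{..<n}. (A $$ (i, k) \<oplus> B $$ (i, k)) \<otimes> C $$ (k, j))
      = (\<Oplus>k\<in>{..<n}. A $$ (i, k) \<otimes> C $$ (k, j)) \<oplus> (\<Oplus>k\<in>{..<n}. B $$ (i, k) \<otimes> C $$ (k, j))"
    if "i < n" "j < n" for i j
    using cl that
    by (intro trans[OF finsum_cong' finsum_addf]) (auto simp: l_distr)
  then show "(A \<oplus>\<^bsub>?M\<^esub> B) \<otimes>\<^bsub>?M\<^esub> C = A \<otimes>\<^bsub>?M\<^esub> C \<oplus>\<^bsub>?M\<^esub> B \<otimes>\<^bsub>?M\<^esub> C"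
    using cl by (auto simp: matrix_ring_def intro!: eq_matI cong: finsum_cong)
  have "(\<Oplus>k\<in>{..<n}. C $$ (i, k) \<otimes> (A $$ (k, j) \<oplus> B $$ (k, j)))
      = (\<Oplus>k\<in>{..<n}. C $$ (i, k) \<otimes> A $$ (k, j)) \<oplus> (\<Oplus>k\<in>{..<n}. C $$ (i, k) \<otimes> B $$ (k, j))"
    if "i < n" "j < n" for i j
    using cl that
    by (intro trans[OF finsum_cong' finsum_addf]) (auto simp: r_distr)
  then show "C \<otimes>\<^bsub>?M\<^esub> (A \<oplus>\<^bsub>?M\<^esub> B) = C \<otimes>\<^bsub>?M\<^esub> A \<oplus>\<^bsub>?M\<^esub> C \<otimes>\<^bsub>?M\<^esub> B"
    using cl by (auto simp: matrix_ring_def intro!: eq_matI cong: finsum_cong)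
qed

end

theory Submission
  imports Defs
begin

text \<open>
  Decomposing the unit \<open>2\<close> shows that \<open>R\<close> has positive characteristic, so a triangular matrix over
  \<open>R\<close> whose diagonal consists of torsion units is itself a torsion unit. Hence a matrix whose
  diagonal entries all lie outside \<open>J(R)\<close> splits: write each diagonal entry as \<open>u + q\<close>, and put the
  \<open>u\<close>'s with the part below the diagonal and the \<open>q\<close>'s with the part above it. Any matrix with an
  entry outside \<open>J(R)\<close> is conjugate to such a matrix by transvections with scalars from
  \<open>{1, c}\<close>, where \<open>c \<noteq> 0, 1\<close> lies in \<open>F\<close>; having two nonzero scalars with invertible difference keeps a
  good diagonal entry good while repairing a bad one. Finally \<open>M\<^sub>n(J(R)) \<subseteq> J(M\<^sub>n(R))\<close>, column by column.
\<close>

section \<open>Left ideals and the Jacobson radical\<close>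

lemma (in abelian_group) minus_zero_imp_eq:
  assumes "a \<in> carrier G" "b \<in> carrier G" "a \<ominus> b = \<zero>"
  shows "a = b"
  using assms minus_equality[of a "\<ominus> b"] by (simp add: a_minus_def)

lemma (in ring) left_idealI:
  assumes "I \<subseteq> carrier R" "\<zero> \<in> I" "\<And>x y. x \<in> I \<Longrightarrow> y \<in> I \<Longrightarrow> x \<oplus> y \<in> I"
    and l: "\<And>x y. x \<in> I \<Longrightarrow> y \<in> carrier R \<Longrightarrow> y \<otimes> x \<in> I"
  shows "left_ideal I R"
proof -
  \<comment> \<open>Negation is left multiplication by \<open>\<ominus> \<one>\<close>, so closure
    under it follows from \<open>l\<close>.\<close>
  have "\<ominus> x \<in> I" if "x \<in> I" for x
    using l[OF that, of "\<ominus> \<one>"] that assms(1) by (auto simp: l_minus)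
  then have "subgroup I (add_monoid R)"
    using assms by (intro add.subgroupI) (auto simp: a_inv_def)
  then show ?thesis
    by (intro left_ideal.intro additive_subgroup.intro left_ideal_axioms.intro ring_axioms l)
qed

context left_ideal
begin

lemma minus_closed_ideal: "x \<in> I \<Longrightarrow> \<ominus> x \<in> I"
  by simp

lemma diff_closed_ideal: "x \<in> I \<Longrightarrow> y \<in> I \<Longrightarrow> x \<ominus> y \<in> I"
  by (simp add: minus_eq)

lemma add_in_iff: "x \<in> I \<Longrightarrow> y \<in> carrier R \<Longrightarrow> x \<oplus> y \<in> I \<longleftrightarrow> y \<in> I"
proof
  assume x: "x \<in> I" and y: "y \<in> carrier R" and xy: "x \<oplus> y \<in> I"
  have "\<ominus> x \<oplus> (x \<oplus> y) \<in> I"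
    using additive_subgroup.a_closed[OF additive_subgroup_axioms minus_closed_ideal[OF x] xy] .
  then show "y \<in> I" using r_neg1[OF a_Hcarr[OF x] y] by simp
qed (rule additive_subgroup.a_closed[OF additive_subgroup_axioms])

text \<open>Multiplying \<open>c \<otimes> x\<close> by the left inverse \<open>z\<close> gives back
  \<open>x\<close>. Later \<open>c\<close> is the image of a nonzero scalar.\<close>

lemma left_unit_mult_in_iff:
  assumes "z \<in> carrier R" "c \<in> carrier R" "z \<otimes> c = \<one>" "x \<in> carrier R"
  shows "c \<otimes> x \<in> I \<longleftrightarrow> x \<in> I"
  by (metis I_l_closed assms l_one m_assoc)

lemma one_in_imp_carrier: "\<one> \<in> I \<Longrightarrow> I = carrier R"
  using I_l_closed[of \<one>] a_subset by auto

end

context ring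
begin

lemma left_ideal_finsum_closed:
  assumes "left_ideal I R" "\<And>k. k \<in> X \<Longrightarrow> f k \<in> I"
  shows "(\<Oplus>k\<in>X. f k) \<in> I"
proof -
  interpret left_ideal I R by fact
  \<comment> \<open>For an infinite \<open>X\<close> the sum has the default value
    \<open>\<zero>\<close>, which lies in \<open>I\<close>.\<close>
  show ?thesis
    using assms(2) by (induction X rule: infinite_finite_induct) (auto simp: Pi_def)
qed

text \<open>Zorn's lemma for the left ideals that contain \<open>K\<close> and miss
  \<open>\<one>\<close>. Missing \<open>\<one>\<close> expresses properness by a condition that
  survives unions of chains.\<close>

lemma exists_maximal_left_ideal:
  assumes K: "left_ideal K R" and "\<one> \<notin> K"
  shows "\<exists>I. maximal_left_ideal I R \<and> K \<subseteq> I"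
proof -
  define X where "X = {I. left_ideal I R \<and> \<one> \<notin> I \<and> K \<subseteq> I}"
  have "\<exists>M\<in>X. \<forall>I\<in>X. M \<subseteq> I \<longrightarrow> I = M"
  proof (rule subset_Zorn_nonempty)
    show "X \<noteq> {}" using assms by (auto simp: X_def)
    fix C assume C: "C \<noteq> {}" "subset.chain X C"
    have li: "left_ideal I R" if "I \<in> C" for I
      using C(2) that by (auto simp: subset.chain_def X_def)
    have "left_ideal (\<Union>C) R"
    proof (rule left_idealI)
      show "\<Union>C \<subseteq> carrier R"
        using li additive_subgroup.a_subset left_ideal.axioms(1) by blast
      show "\<zero> \<in> \<Union>C"
        using li C(1) additive_subgroup.zero_closed left_ideal.axioms(1) by blast
      fix x y assume "x \<in> \<Union>C"
      then obtain I where I: "x \<in> I" "I \<in> C" by blast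
      show "y \<otimes> x \<in> \<Union>C" if "y \<in> carrier R"
        using I left_ideal.I_l_closed[OF li] that by blast
      assume "y \<in> \<Union>C"
      then obtain I' where I': "y \<in> I'" "I' \<in> C" by blast
      have "I \<subseteq> I' \<or> I' \<subseteq> I"
        using C(2) I I' by (auto simp: subset.chain_def)
      then show "x \<oplus> y \<in> \<Union>C"
        using I I' additive_subgroup.a_closed[OF left_ideal.axioms(1)[OF li]] by blast
    qed
    then show "\<Union>C \<in> X"
      using C by (auto simp: X_def subset.chain_def)
  qed
  then obtain M where M: "M \<in> X" "\<And>I. I \<in> X \<Longrightarrow> M \<subseteq> I \<Longrightarrow> I = M" by blast
  interpret M: left_ideal M R using M(1) by (simp add: X_def)
  have "maximal_left_ideal M R"
  proof unfold_locales
    show "M \<noteq> carrier R" using M(1) by (auto simp: X_def)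
    fix I assume I: "left_ideal I R" "M \<subseteq> I"
    show "I = M \<or> I = carrier R"
      using left_ideal.one_in_imp_carrier[OF I(1)] I M by (auto simp: X_def)
  qed
  then show ?thesis using M(1) by (auto simp: X_def)
qed

lemma jacobson_left_ideal: "left_ideal (jacobson_radical R) R"
proof (rule left_idealI)
  note * = maximal_left_ideal.axioms(1)
  note ** = *[THEN left_ideal.axioms(1)]
  show "jacobson_radical R \<subseteq> carrier R" by (auto simp: jacobson_radical_def)
  show "\<zero> \<in> jacobson_radical R"
    by (auto simp: jacobson_radical_def intro: additive_subgroup.zero_closed[OF **])
  show "x \<oplus> y \<in> jacobson_radical R"
    if "x \<in> jacobson_radical R" "y \<in> jacobson_radical R" for x y
    using that by (auto simp: jacobson_radical_def intro: additive_subgroup.a_closed[OF **])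
  show "y \<otimes> x \<in> jacobson_radical R"
    if "x \<in> jacobson_radical R" "y \<in> carrier R" for x y
    using that by (auto simp: jacobson_radical_def intro: left_ideal.I_l_closed[OF *])
qed

lemma principal_left_ideal:
  assumes "a \<in> carrier R"
  shows "left_ideal ((\<lambda>r. r \<otimes> a) ` carrier R) R"
proof (rule left_idealI)
  show "\<zero> \<in> (\<lambda>r. r \<otimes> a) ` carrier R"
    using assms by (intro image_eqI[of _ _ \<zero>]) auto
next
  fix x y assume x: "x \<in> (\<lambda>r. r \<otimes> a) ` carrier R"
  show "x \<oplus> y \<in> (\<lambda>r. r \<otimes> a) ` carrier R" if "y \<in> (\<lambda>r. r \<otimes> a) ` carrier R"
    using x that assms by (auto simp: l_distr[symmetric])
  show "y \<otimes> x \<in> (\<lambda>r. r \<otimes> a) ` carrier R" if "y \<in> carrier R"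
    using x that assms by (auto simp: m_assoc[symmetric])
qed (use assms in auto)

text \<open>Otherwise the left ideal generated by \<open>\<one> \<ominus> x\<close> is proper and
  lies in a maximal one. That one also contains \<open>x\<close>, hence
  \<open>\<one>\<close>.\<close>

lemma jacobson_left_inverse:
  assumes x: "x \<in> jacobson_radical R"
  shows "\<exists>w\<in>carrier R. w \<otimes> (\<one> \<ominus> x) = \<one>"
proof (rule ccontr)
  assume no: "\<not> ?thesis"
  have xc: "x \<in> carrier R" using x by (simp add: jacobson_radical_def)
  let ?K = "(\<lambda>r. r \<otimes> (\<one> \<ominus> x)) ` carrier R"
  have "\<one> \<notin> ?K" using no by auto
  then obtain I where I: "maximal_left_ideal I R" "?K \<subseteq> I"
    using exists_maximal_left_ideal principal_left_ideal xc by (metis minus_closed one_closed)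
  interpret I: maximal_left_ideal I R by fact
  have "\<one> \<ominus> x \<in> I" using I(2) xc by (force intro: image_eqI[of _ _ \<one>])
  moreover have "x \<in> I" using x I(1) by (auto simp: jacobson_radical_def)
  ultimately have "(\<one> \<ominus> x) \<oplus> x \<in> I" by auto
  then have "\<one> \<in> I" using xc by (simp add: minus_eq a_assoc l_neg)
  then show False using I.one_in_imp_carrier I.I_notcarr by simp
qed

text \<open>If a maximal left ideal \<open>I\<close> misses \<open>x\<close>, then
  \<open>R x + I\<close> is the whole ring and \<open>\<one> = y \<otimes> x \<oplus> z\<close> with
  \<open>z\<close> in \<open>I\<close>. But then \<open>z = \<one> \<ominus> y \<otimes> x\<close>
  is left invertible, which forces \<open>\<one>\<close> into \<open>I\<close>.\<close>

lemma jacobson_memI: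
  assumes x: "x \<in> carrier R"
    and inv: "\<And>y. y \<in> carrier R \<Longrightarrow> \<exists>w\<in>carrier R. w \<otimes> (\<one> \<ominus> y \<otimes> x) = \<one>"
  shows "x \<in> jacobson_radical R"
  unfolding jacobson_radical_def
proof (clarsimp simp: x)
  fix I assume "maximal_left_ideal I R"
  then interpret I: maximal_left_ideal I R .
  show "x \<in> I"
  proof (rule ccontr)
    assume "x \<notin> I"
    define K where "K = {y \<otimes> x \<oplus> z |y z. y \<in> carrier R \<and> z \<in> I}"
    have memI: "y \<otimes> x \<oplus> z \<in> K" if "y \<in> carrier R" "z \<in> I" for y z
      using that unfolding K_def by blast
    have memE: "\<exists>y z. y \<in> carrier R \<and> z \<in> I \<and> s = y \<otimes> x \<oplus> z" if "s \<in> K" for s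
      using that unfolding K_def by blast
    have "left_ideal K R"
    proof (rule left_idealI)
      show "K \<subseteq> carrier R" using x memE by fastforce
      show "\<zero> \<in> K" using x memI[of \<zero> \<zero>] by simp
      fix s t assume "s \<in> K"
      then obtain y z where s: "y \<in> carrier R" "z \<in> I" "s = y \<otimes> x \<oplus> z" using memE by blast
      show "t \<otimes> s \<in> K" if "t \<in> carrier R"
        using memI[of "t \<otimes> y" "t \<otimes> z"] s that x I.a_Hcarr I.I_l_closed
        by (simp add: r_distr m_assoc)
      assume "t \<in> K"
      then obtain y' z' where t: "y' \<in> carrier R" "z' \<in> I" "t = y' \<otimes> x \<oplus> z'"
        using memE by blast
      have "s \<oplus> t = (y \<oplus> y') \<otimes> x \<oplus> (z \<oplus> z')"
        using s t x I.a_Hcarr by (simp add: l_distr a_ac)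
      then show "s \<oplus> t \<in> K" using s t memI by simp
    qed
    moreover have "I \<subseteq> K"
      using memI[of \<zero>] x I.a_Hcarr by fastforce
    moreover have "x \<in> K"
      using memI[of \<one> \<zero>] x by simp
    ultimately have "K = carrier R" using I.I_maximal \<open>x \<notin> I\<close> by blast
    then obtain y z where yz: "y \<in> carrier R" "z \<in> I" "\<one> = y \<otimes> x \<oplus> z"
      using memE one_closed by blast
    have "y \<otimes> x \<oplus> z \<ominus> y \<otimes> x = z"
      using x yz(1,2) I.a_Hcarr by (simp add: minus_eq a_ac r_neg)
    then have "\<one> \<ominus> y \<otimes> x = z" by (simp only: yz(3))
    then have "\<one> \<in> I" using inv[OF yz(1)] I.I_l_closed[OF yz(2)] by metis
    then show False using I.one_in_imp_carrier I.I_notcarr by simp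
  qed
qed

section \<open>Torsion units, nilpotent elements and conjugation\<close>

lemma torsion_unitsI:
  assumes "x \<in> carrier R" "1 \<le> (m::nat)" "x [^] m = \<one>"
  shows "x \<in> torsion_units R"
proof -
  \<comment> \<open>The power \<open>x [^] k\<close> with \<open>k = m - 1\<close> is the inverse of
    \<open>x\<close>.\<close>
  obtain k where "m = Suc k" using assms(2) by (cases m) auto
  then have "x [^] k \<otimes> x = \<one>" "x \<otimes> x [^] k = \<one>"
    using assms nat_pow_Suc2[of x k] by auto
  then show ?thesis
    using assms by (auto simp: torsion_units_def Units_def intro!: exI[of _ "x [^] k"])
qed

text \<open>The product collapses from the inside, one factor \<open>z \<otimes> q\<close> at a
  time, so \<open>z\<close> and \<open>q\<close> may fail to commute.\<close>

lemma left_invertible_pow: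
  assumes "z \<in> carrier R" "q \<in> carrier R" "z \<otimes> q = \<one>"
  shows "z [^] (k::nat) \<otimes> q [^] k = \<one>"
proof (induction k)
  case (Suc k)
  have "z [^] Suc k \<otimes> q [^] Suc k = z [^] k \<otimes> (z \<otimes> q) \<otimes> q [^] k"
    unfolding nat_pow_Suc2[OF assms(2)] using assms(1,2) by (simp add: m_assoc)
  then show ?case using Suc assms by simp
qed simp

lemma nilpotent_left_invertible_imp_trivial:
  assumes "z \<in> carrier R" "q \<in> nilpotents R" "z \<otimes> q = \<one>"
  shows "\<one> = \<zero>"
proof -
  obtain k :: nat where "q [^] k = \<zero>" "q \<in> carrier R" using assms(2) by (auto simp: nilpotents_def)
  then show ?thesis using left_invertible_pow[of z q k] assms by simp
qed

text \<open>If \<open>u \<oplus> q\<close> lay in the radical, so would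
  \<open>inv u \<otimes> (u \<oplus> q)\<close>. Subtracting this from \<open>\<one>\<close> leaves
  \<open>\<ominus> (inv u \<otimes> q)\<close>, which would be left invertible, so the nilpotent
  \<open>q\<close> would have a left inverse. For the matrix ring this is the easy inclusion of the
  theorem.\<close>

lemma torsion_plus_nilpotent_not_jacobson:
  assumes "\<one> \<noteq> \<zero>" "u \<in> torsion_units R" "q \<in> nilpotents R"
  shows "u \<oplus> q \<notin> jacobson_radical R"
proof
  interpret J: left_ideal "jacobson_radical R" R by (rule jacobson_left_ideal)
  assume j: "u \<oplus> q \<in> jacobson_radical R"
  have u: "u \<in> Units R" "u \<in> carrier R" "inv u \<in> carrier R"
    using assms(2) by (auto simp: torsion_units_def)
  have q: "q \<in> carrier R" using assms(3) by (auto simp: nilpotents_def)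
  obtain w where w: "w \<in> carrier R" "w \<otimes> (\<one> \<ominus> inv u \<otimes> (u \<oplus> q)) = \<one>"
    using jacobson_left_inverse J.I_l_closed[OF j u(3)] by blast
  have "\<one> \<ominus> inv u \<otimes> (u \<oplus> q) = \<ominus> (inv u \<otimes> q)"
    using u q by (simp add: r_distr minus_eq minus_add r_neg2)
  then have "\<ominus> (w \<otimes> inv u) \<otimes> q = \<one>"
    using w u q by (simp add: l_minus r_minus m_assoc)
  then show False
    using nilpotent_left_invertible_imp_trivial[of "\<ominus> (w \<otimes> inv u)" q] assms w u by simp
qed

lemma conjugate_pow:
  assumes "P \<in> carrier R" "Q \<in> carrier R" "P \<otimes> Q = \<one>" "x \<in> carrier R"
    and "Q \<otimes> P = \<one>"
  shows "(Q \<otimes> x \<otimes> P) [^] (k::nat) = Q \<otimes> x [^] k \<otimes> P"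
proof (induction k)
  case (Suc k)
  have "(Q \<otimes> x \<otimes> P) [^] Suc k = Q \<otimes> x [^] k \<otimes> (P \<otimes> Q) \<otimes> x \<otimes> P"
    using assms(1,2,4) Suc by (simp add: m_assoc)
  then show ?case using assms by (simp add: m_assoc)
qed (use assms in simp)

text \<open>Conjugation is a ring automorphism, so it respects both torsion units and nilpotents,
  and a decomposition found after conjugating can be pulled back.\<close>

lemma conjugate_torsion_plus_nilpotent:
  assumes PQ: "P \<in> carrier R" "Q \<in> carrier R" "P \<otimes> Q = \<one>" "Q \<otimes> P = \<one>"
    and x: "x \<in> carrier R" and "P \<otimes> x \<otimes> Q \<in> torsion_units R <+>\<^bsub>R\<^esub> nilpotents R"
  shows "x \<in> torsion_units R <+>\<^bsub>R\<^esub> nilpotents R"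
proof -
  obtain u q where uq: "u \<in> torsion_units R" "q \<in> nilpotents R" "P \<otimes> x \<otimes> Q = u \<oplus> q"
    using assms(6) by (auto simp: set_add_def')
  have c: "u \<in> carrier R" "q \<in> carrier R"
    using uq by (auto simp: torsion_units_def nilpotents_def)
  have "Q \<otimes> (P \<otimes> x \<otimes> Q) \<otimes> P = (Q \<otimes> P) \<otimes> x \<otimes> (Q \<otimes> P)"
    using PQ(1,2) x by (simp add: m_assoc)
  then have "x = Q \<otimes> u \<otimes> P \<oplus> Q \<otimes> q \<otimes> P"
    using uq(3) PQ x c by (simp add: l_distr r_distr)
  moreover have "Q \<otimes> u \<otimes> P \<in> torsion_units R"
  proof -
    obtain m :: nat where "1 \<le> m" "u [^] m = \<one>" using uq(1) by (auto simp: torsion_units_def)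
    then show ?thesis
      using PQ c conjugate_pow[OF PQ(1-3) c(1) PQ(4)] by (intro torsion_unitsI[of _ m]) auto
  qed
  moreover have "Q \<otimes> q \<otimes> P \<in> nilpotents R"
    using uq(2) PQ c conjugate_pow[OF PQ(1-3) c(2) PQ(4)] by (auto simp: nilpotents_def)
  ultimately show ?thesis by (auto simp: set_add_def')
qed

text \<open>The binomial theorem modulo \<open>q\<close>. The cofactor \<open>t\<close> is required
  to commute with \<open>q\<close> so that \<open>q \<otimes> t\<close> is nilpotent whenever
  \<open>q\<close> is.\<close>

lemma commuting_binomial_pow:
  assumes "x \<in> carrier R" "q \<in> carrier R" "x \<otimes> q = q \<otimes> x"
  shows "\<exists>t\<in>carrier R. q \<otimes> t = t \<otimes> q \<and> (x \<oplus> q) [^] (m::nat) = x [^] m \<oplus> q \<otimes> t"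
proof (induction m)
  case 0
  show ?case using assms by (intro bexI[of _ \<zero>]) auto
next
  case (Suc m)
  then obtain t where t: "t \<in> carrier R" "q \<otimes> t = t \<otimes> q" "(x \<oplus> q) [^] m = x [^] m \<oplus> q \<otimes> t"
    by blast
  have xm: "x [^] m \<otimes> q = q \<otimes> x [^] m" using assms by (intro group_commutes_pow) auto
  \<comment> \<open>Read off from the expansion of
    \<open>(x [^] m \<oplus> q \<otimes> t) \<otimes> (x \<oplus> q)\<close> after moving
    \<open>q\<close> to the front of \<open>x [^] m \<otimes> q\<close>.\<close>
  let ?t = "x [^] m \<oplus> (t \<otimes> x \<oplus> t \<otimes> q)"
  have "(x \<oplus> q) [^] Suc m = x [^] Suc m \<oplus> (x [^] m \<otimes> q \<oplus> (q \<otimes> (t \<otimes> x) \<oplus> q \<otimes> (t \<otimes> q)))"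
    using t(1,3) assms(1,2) by (simp add: l_distr r_distr m_assoc a_ac)
  also have "\<dots> = x [^] Suc m \<oplus> q \<otimes> ?t"
    using t(1) assms(1,2) by (simp add: xm r_distr)
  finally have "(x \<oplus> q) [^] Suc m = x [^] Suc m \<oplus> q \<otimes> ?t" .
  moreover have "q \<otimes> ?t = ?t \<otimes> q"
  proof -
    have "q \<otimes> (t \<otimes> x) = t \<otimes> x \<otimes> q"
      using t(1,2) assms by (metis m_assoc)
    moreover have "q \<otimes> (t \<otimes> q) = t \<otimes> q \<otimes> q"
      using t(1,2) assms by (metis m_assoc)
    ultimately show ?thesis
      using t(1) assms(1,2) xm by (simp add: l_distr r_distr)
  qed
  ultimately show ?case using t assms by (intro bexI[of _ ?t]) auto
qed

text \<open>Turns powers of the ring element 2 into integer multiples of \<open>\<one>\<close>, the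
  elements for which left inverses are available below.\<close>

lemma two_pow: "(\<one> \<oplus> \<one>) [^] (m::nat) = add_pow R ((2::nat) ^ m) \<one>"
proof (induction m)
  case (Suc m)
  have "add_pow R ((2::nat) ^ Suc m) \<one> = add_pow R ((2::nat) ^ m) \<one> \<oplus> add_pow R ((2::nat) ^ m) \<one>"
    using add.nat_pow_mult[of \<one> "2 ^ m" "2 ^ m"] by (simp add: mult_2)
  then show ?case using Suc by (simp add: r_distr)
qed simp

end

section \<open>Positive characteristic of generalized t-fine rings\<close>

context generalized_t_fine
begin

text \<open>In the zero ring the radical is everything, so the left side of the defining equation is
  empty, while the right side always contains \<open>\<one> \<oplus> \<zero>\<close>.\<close>

lemma one_not_zero: "\<one> \<noteq> \<zero>"
proof
  assume *: "\<one> = \<zero>"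
  then have "carrier R = {\<zero>}" by (rule one_zeroD)
  then have "carrier R - jacobson_radical R = {}"
    using additive_subgroup.zero_closed[OF left_ideal.axioms(1)[OF jacobson_left_ideal]] by simp
  moreover have "\<one> \<in> torsion_units R" "\<zero> \<in> nilpotents R"
    by (auto simp: nilpotents_def intro!: torsion_unitsI[of _ 1] exI[of _ "1::nat"])
  ultimately show False
    using sum_decomposition by (auto simp: set_add_def')
qed

text \<open>Otherwise \<open>2 = u + q\<close> with \<open>u ^ m = 1\<close> makes the unit \<open>2 ^ m - 1\<close> a multiple of the
  nilpotent \<open>q\<close>, which commutes with \<open>u\<close>.\<close>

lemma finite_characteristic:
  assumes inv: "\<And>k::nat. add_pow R k \<one> \<noteq> \<zero> \<Longrightarrow> \<exists>z\<in>carrier R. z \<otimes> add_pow R k \<one> = \<one>"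
  shows "\<exists>k::nat. 1 \<le> k \<and> add_pow R k \<one> = \<zero>"
proof (rule ccontr)
  assume "\<not> ?thesis"
  then have inv: "\<exists>z\<in>carrier R. z \<otimes> add_pow R k \<one> = \<one>" if "1 \<le> k" for k :: nat
    using assms that by blast
  interpret J: left_ideal "jacobson_radical R" R by (rule jacobson_left_ideal)
  let ?x = "\<one> \<oplus> \<one>"
  obtain z where z: "z \<in> carrier R" "z \<otimes> ?x = \<one>"
    using inv[of 2] two_pow[of 1] by auto
  have "\<one> \<notin> jacobson_radical R"
    using jacobson_left_inverse[of \<one>] one_not_zero by (auto simp: minus_eq r_neg)
  then have "?x \<in> carrier R - jacobson_radical R"
    using J.I_l_closed z by fastforce
  then obtain u q where uq: "u \<in> torsion_units R" "q \<in> nilpotents R" "?x = u \<oplus> q"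
    unfolding sum_decomposition by (auto simp: set_add_def')
  obtain m k :: nat where mk: "1 \<le> m" "u [^] m = \<one>" "q [^] k = \<zero>"
    using uq by (auto simp: torsion_units_def nilpotents_def)
  have c: "u \<in> carrier R" "q \<in> carrier R"
    using uq by (auto simp: torsion_units_def nilpotents_def)
  \<comment> \<open>Since \<open>u\<close> is 2 minus \<open>q\<close> and 2 is central, expanding
    modulo \<open>q\<close> turns \<open>u [^] m = \<one>\<close> into an equation between
    \<open>2 ^ m - 1\<close> and a multiple of \<open>q\<close>.\<close>
  have u: "u = ?x \<oplus> \<ominus> q"
    unfolding uq(3) using c by (simp add: a_assoc r_neg)
  obtain t where t: "t \<in> carrier R" "\<ominus> q \<otimes> t = t \<otimes> \<ominus> q" "u [^] m = ?x [^] m \<oplus> \<ominus> q \<otimes> t"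
    unfolding u using commuting_binomial_pow[of ?x "\<ominus> q" m] c by (auto simp: l_distr r_distr)
  let ?p = "add_pow R ((2::nat) ^ m - 1) \<one>"
  have "Suc (2 ^ m - 1) = 2 ^ m" by simp
  then have "?x [^] m = ?p \<oplus> \<one>"
    unfolding two_pow by (metis add.nat_pow_Suc)
  then have "?p \<oplus> \<one> \<oplus> \<ominus> q \<otimes> t = \<one>" using t(3) mk(2) by simp
  then have "(?p \<ominus> q \<otimes> t) \<oplus> \<one> = \<one>" using c t(1) by (simp add: minus_eq l_minus a_ac)
  then have "?p \<ominus> q \<otimes> t = \<zero>" using c t(1) by (metis add.r_cancel_one m_closed minus_closed
    add.nat_pow_closed one_closed)
  then have p: "?p = q \<otimes> t"
    using minus_zero_imp_eq c(2) t(1) m_closed add.nat_pow_closed one_closed by metis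
  have "q \<otimes> t = t \<otimes> q"
    using t(1,2) c by (metis l_minus m_closed minus_minus r_minus)
  then have "(q \<otimes> t) [^] k = \<zero>"
    using pow_mult_distrib[of q t k] c t(1) mk(3) by simp
  \<comment> \<open>The exponent \<open>k\<close> is positive, because \<open>k = 0\<close> would
    give \<open>\<one> = \<zero>\<close>.\<close>
  then have "q \<otimes> t \<in> nilpotents R"
    using c t(1) one_not_zero by (cases k) (auto simp: nilpotents_def intro!: exI[of _ k])
  moreover have "1 \<le> (2::nat) ^ m - 1"
    using power_increasing[OF mk(1), of "2::nat"] by simp
  then obtain y where "y \<in> carrier R" "y \<otimes> ?p = \<one>" using inv by blast
  ultimately show False
    using nilpotent_left_invertible_imp_trivial one_not_zero p by metis
qed

end

section \<open>Matrices over a ring\<close>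

lemma (in abelian_monoid) finsum_eq_single:
  assumes "finite X" "i \<in> X" "f i \<in> carrier G" "\<And>k. k \<in> X \<Longrightarrow> k \<noteq> i \<Longrightarrow> f k = \<zero>"
  shows "(\<Oplus>k\<in>X. f k) = f i"
proof -
  have "(\<Oplus>k\<in>X. f k) = (\<Oplus>k\<in>X. if i = k then f i else \<zero>)"
    using assms by (intro finsum_cong') auto
  also have "\<dots> = f i"
    using assms(1-3) add.finprod_singleton[of i X "\<lambda>_. f i"] by simp
  finally show ?thesis .
qed

locale square_matrices = ring R for R (structure) + fixes n :: nat
begin

abbreviation S where "S \<equiv> matrix_ring n R"

sublocale M: ring S
  by (rule matrix_ring_is_ring)

lemma entry_closed:
  "A \<in> carrier S \<Longrightarrow> i < n \<Longrightarrow> j < n \<Longrightarrow> A $$ (i, j) \<in> carrier R"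
  by (simp add: matrix_ring_def)

lemma mat_carrier: "(\<And>i j. i < n \<Longrightarrow> j < n \<Longrightarrow> f (i, j) \<in> carrier R) \<Longrightarrow> mat n n f \<in> carrier S"
  by (simp add: matrix_ring_def)

lemma matrix_eqI:
  assumes "A \<in> carrier S" "B \<in> carrier S" "\<And>i j. i < n \<Longrightarrow> j < n \<Longrightarrow> A $$ (i, j) = B $$ (i, j)"
  shows "A = B"
  using assms by (intro eq_matI) (auto simp: matrix_ring_def)

lemma mult_entry:
  "i < n \<Longrightarrow> j < n \<Longrightarrow> (A \<otimes>\<^bsub>S\<^esub> B) $$ (i, j) = (\<Oplus>k\<in>{..<n}. A $$ (i, k) \<otimes> B $$ (k, j))"
  by (simp add: matrix_ring_def)

lemma add_entry [simp]:
  "i < n \<Longrightarrow> j < n \<Longrightarrow> (A \<oplus>\<^bsub>S\<^esub> B) $$ (i, j) = A $$ (i, j) \<oplus> B $$ (i, j)"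
  by (simp add: matrix_ring_def)

lemma one_entry [simp]:
  "i < n \<Longrightarrow> j < n \<Longrightarrow> \<one>\<^bsub>S\<^esub> $$ (i, j) = (if i = j then \<one> else \<zero>)"
  by (simp add: matrix_ring_def)

lemma zero_entry [simp]: "i < n \<Longrightarrow> j < n \<Longrightarrow> \<zero>\<^bsub>S\<^esub> $$ (i, j) = \<zero>"
  by (simp add: matrix_ring_def)

declare entry_closed [simp]

lemma neg_entry [simp]:
  assumes "A \<in> carrier S" "i < n" "j < n"
  shows "(\<ominus>\<^bsub>S\<^esub> A) $$ (i, j) = \<ominus> (A $$ (i, j))"
proof -
  have "(\<ominus>\<^bsub>S\<^esub> A \<oplus>\<^bsub>S\<^esub> A) $$ (i, j) = \<zero>"
    using assms by (simp add: M.l_neg del: add_entry)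
  then show ?thesis
    using assms by (intro minus_equality[symmetric]) auto
qed

lemma diff_entry [simp]:
  "A \<in> carrier S \<Longrightarrow> B \<in> carrier S \<Longrightarrow> i < n \<Longrightarrow> j < n \<Longrightarrow>
    (A \<ominus>\<^bsub>S\<^esub> B) $$ (i, j) = A $$ (i, j) \<ominus> B $$ (i, j)"
  by (simp add: a_minus_def)

lemma mult_entry_single:
  assumes "A \<in> carrier S" "B \<in> carrier S" "i < n" "j < n" "l < n"
    and "\<And>k. k < n \<Longrightarrow> k \<noteq> l \<Longrightarrow> A $$ (i, k) = \<zero> \<or> B $$ (k, j) = \<zero>"
  shows "(A \<otimes>\<^bsub>S\<^esub> B) $$ (i, j) = A $$ (i, l) \<otimes> B $$ (l, j)"
  unfolding mult_entry[OF assms(3,4)]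
proof (rule finsum_eq_single)
  fix k assume "k \<in> {..<n}" "k \<noteq> l"
  then show "A $$ (i, k) \<otimes> B $$ (k, j) = \<zero>"
    using assms(1-5) assms(6)[of k] by auto
qed (use assms(1-5) in auto)

lemma mult_entry_zero:
  assumes "A \<in> carrier S" "B \<in> carrier S" "i < n" "j < n"
    and "\<And>k. k < n \<Longrightarrow> A $$ (i, k) = \<zero> \<or> B $$ (k, j) = \<zero>"
  shows "(A \<otimes>\<^bsub>S\<^esub> B) $$ (i, j) = \<zero>"
  unfolding mult_entry[OF assms(3,4)]
proof (rule add.finprod_one_eqI)
  fix k assume "k \<in> {..<n}"
  then show "A $$ (i, k) \<otimes> B $$ (k, j) = \<zero>"
    using assms(1-4) assms(5)[of k] by auto
qed

text \<open>A matrix supported in column \<open>l\<close> satisfies \<open>C^2 = C c\<close> with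
  \<open>c\<close> its entry at \<open>(l, l)\<close>. The geometric series then suggests
  \<open>1 + C w\<close> as left inverse of \<open>1 - C\<close>, where \<open>w\<close> is a left
  inverse of \<open>1 - c\<close>.\<close>

lemma column_left_inverse:
  assumes C: "C \<in> carrier S" and l: "l < n"
    and zero: "\<And>i j. i < n \<Longrightarrow> j < n \<Longrightarrow> j \<noteq> l \<Longrightarrow> C $$ (i, j) = \<zero>"
    and w: "w \<in> carrier R" "w \<otimes> (\<one> \<ominus> C $$ (l, l)) = \<one>"
  shows "\<exists>W\<in>carrier S. W \<otimes>\<^bsub>S\<^esub> (\<one>\<^bsub>S\<^esub> \<ominus>\<^bsub>S\<^esub> C) = \<one>\<^bsub>S\<^esub>"
proof
  define B where "B = mat n n (\<lambda>(i, j). if j = l then C $$ (i, l) \<otimes> w else \<zero>)"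
  have B: "B \<in> carrier S"
    unfolding B_def using C l w by (intro mat_carrier) auto
  \<comment> \<open>This scalar identity, multiplied on the left by the entries of column
    \<open>l\<close>, gives \<open>B - B C = C\<close>.\<close>
  have w': "w \<ominus> w \<otimes> C $$ (l, l) = \<one>"
    using w C l by (simp add: minus_eq r_distr r_minus)
  have "B \<ominus>\<^bsub>S\<^esub> B \<otimes>\<^bsub>S\<^esub> C = C"
  proof (rule matrix_eqI)
    fix i j assume ij: "i < n" "j < n"
    have BC: "(B \<otimes>\<^bsub>S\<^esub> C) $$ (i, j) = B $$ (i, l) \<otimes> C $$ (l, j)"
      using ij l B C by (intro mult_entry_single) (auto simp: B_def)
    show "(B \<ominus>\<^bsub>S\<^esub> B \<otimes>\<^bsub>S\<^esub> C) $$ (i, j) = C $$ (i, j)"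
    proof (cases "j = l")
      case True
      have "C $$ (i, l) \<otimes> w \<ominus> C $$ (i, l) \<otimes> w \<otimes> C $$ (l, l)
          = C $$ (i, l) \<otimes> (w \<ominus> w \<otimes> C $$ (l, l))"
        using ij l C w(1) by (simp add: minus_eq r_distr r_minus m_assoc)
      also have "\<dots> = C $$ (i, l)"
        unfolding w' using ij l C by simp
      finally show ?thesis
        using True ij B C BC l by (simp add: B_def)
    next
      case False
      then show ?thesis
        using ij B C BC l w zero by (simp add: B_def minus_eq)
    qed
  qed (use B C in auto)
  then have "C \<oplus>\<^bsub>S\<^esub> B \<otimes>\<^bsub>S\<^esub> C = B"
    using B C by (metis a_minus_def M.add.inv_solve_right M.m_closed)
  moreover have "(\<one>\<^bsub>S\<^esub> \<oplus>\<^bsub>S\<^esub> B) \<otimes>\<^bsub>S\<^esub> (\<one>\<^bsub>S\<^esub> \<ominus>\<^bsub>S\<^esub> C) = \<one>\<^bsub>S\<^esub> \<oplus>\<^bsub>S\<^esub> B \<ominus>\<^bsub>S\<^esub> (C \<oplus>\<^bsub>S\<^esub> B \<otimes>\<^bsub>S\<^esub> C)"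
    using B C by (simp add: M.minus_eq M.l_distr M.r_distr M.r_minus M.minus_add M.a_ac)
  ultimately show "(\<one>\<^bsub>S\<^esub> \<oplus>\<^bsub>S\<^esub> B) \<otimes>\<^bsub>S\<^esub> (\<one>\<^bsub>S\<^esub> \<ominus>\<^bsub>S\<^esub> C) = \<one>\<^bsub>S\<^esub>"
    using B by (simp add: M.minus_eq M.a_assoc M.r_neg)
  show "\<one>\<^bsub>S\<^esub> \<oplus>\<^bsub>S\<^esub> B \<in> carrier S" using B by simp
qed

text \<open>A left multiple \<open>Y A\<close> is still supported in column \<open>l\<close>, and
  its entry at \<open>(l, l)\<close> is a sum of left multiples of radical elements. So
  \<open>1 - Y A\<close> has a left inverse for every \<open>Y\<close>.\<close>

lemma column_in_jacobson:
  assumes A: "A \<in> carrier S" and l: "l < n"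
    and J: "\<And>i j. i < n \<Longrightarrow> j < n \<Longrightarrow> A $$ (i, j) \<in> jacobson_radical R"
    and zero: "\<And>i j. i < n \<Longrightarrow> j < n \<Longrightarrow> j \<noteq> l \<Longrightarrow> A $$ (i, j) = \<zero>"
  shows "A \<in> jacobson_radical S"
proof (rule M.jacobson_memI[OF A])
  interpret J: left_ideal "jacobson_radical R" R by (rule jacobson_left_ideal)
  fix Y assume Y: "Y \<in> carrier S"
  have "(Y \<otimes>\<^bsub>S\<^esub> A) $$ (l, l) \<in> jacobson_radical R"
    unfolding mult_entry[OF l l] using J Y l
    by (intro left_ideal_finsum_closed jacobson_left_ideal) (auto intro: J.I_l_closed)
  then obtain w where "w \<in> carrier R" "w \<otimes> (\<one> \<ominus> (Y \<otimes>\<^bsub>S\<^esub> A) $$ (l, l)) = \<one>"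
    using jacobson_left_inverse by blast
  moreover have "(Y \<otimes>\<^bsub>S\<^esub> A) $$ (i, j) = \<zero>" if "i < n" "j < n" "j \<noteq> l" for i j
    using that Y A zero by (intro mult_entry_zero) auto
  ultimately show "\<exists>W\<in>carrier S. W \<otimes>\<^bsub>S\<^esub> (\<one>\<^bsub>S\<^esub> \<ominus>\<^bsub>S\<^esub> Y \<otimes>\<^bsub>S\<^esub> A) = \<one>\<^bsub>S\<^esub>"
    using column_left_inverse[of "Y \<otimes>\<^bsub>S\<^esub> A" l] Y A l by auto
qed

lemma entries_in_jacobson:
  assumes A: "A \<in> carrier S"
    and J: "\<And>i j. i < n \<Longrightarrow> j < n \<Longrightarrow> A $$ (i, j) \<in> jacobson_radical R"
  shows "A \<in> jacobson_radical S"
proof -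
  interpret J: left_ideal "jacobson_radical R" R by (rule jacobson_left_ideal)
  interpret JS: left_ideal "jacobson_radical S" S by (rule M.jacobson_left_ideal)
  \<comment> \<open>\<open>T m\<close> keeps the first \<open>m\<close> columns of \<open>A\<close>
    and \<open>C m\<close> only column \<open>m\<close>, so \<open>A\<close> is built up by adding
    one column at a time.\<close>
  define T where "T m = mat n n (\<lambda>(i, j). if j < m then A $$ (i, j) else \<zero>)" for m
  define C where "C m = mat n n (\<lambda>(i, j). if j = m then A $$ (i, j) else \<zero>)" for m
  have carrier: "T m \<in> carrier S" "C m \<in> carrier S" for m
    unfolding T_def C_def using A by (auto intro!: mat_carrier)
  have entry: "T m $$ (i, j) = (if j < m then A $$ (i, j) else \<zero>)"
    "C m $$ (i, j) = (if j = m then A $$ (i, j) else \<zero>)" if "i < n" "j < n" for i j m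
    using that by (simp_all add: T_def C_def)
  have "T m \<in> jacobson_radical S" if "m \<le> n" for m
    using that
  proof (induction m)
    case 0
    have "T 0 = \<zero>\<^bsub>S\<^esub>" by (rule matrix_eqI) (simp_all add: carrier entry)
    then show ?case by simp
  next
    case (Suc m)
    have "T (Suc m) = T m \<oplus>\<^bsub>S\<^esub> C m"
      using A by (intro matrix_eqI) (auto simp: carrier entry less_Suc_eq)
    moreover have "C m \<in> jacobson_radical S"
      using Suc.prems J by (intro column_in_jacobson[of _ m]) (auto simp: carrier entry)
    ultimately show ?case using Suc by simp
  qed
  moreover have "T n = A" using A by (intro matrix_eqI) (auto simp: carrier entry)
  ultimately show ?thesis by (metis order_refl)
qed

text \<open>Conjugation by \<open>1 + g E_ij\<close>, where \<open>E_ij\<close> is the matrix unit: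
  it adds \<open>g\<close> times row \<open>j\<close> to row \<open>i\<close> and then subtracts
  column \<open>i\<close> times \<open>g\<close> from column \<open>j\<close>. Since
  \<open>i \<noteq> j\<close>, the matrix \<open>g E_ij\<close> squares to zero and the inverse is
  \<open>1 - g E_ij\<close>.\<close>

lemma transvection:
  assumes A: "A \<in> carrier S" and ij: "i < n" "j < n" "i \<noteq> j" and g: "g \<in> carrier R"
  obtains P Q where "P \<in> carrier S" "Q \<in> carrier S" "P \<otimes>\<^bsub>S\<^esub> Q = \<one>\<^bsub>S\<^esub>" "Q \<otimes>\<^bsub>S\<^esub> P = \<one>\<^bsub>S\<^esub>"
    "\<And>k. k < n \<Longrightarrow> k \<noteq> i \<Longrightarrow> k \<noteq> j \<Longrightarrow> (P \<otimes>\<^bsub>S\<^esub> A \<otimes>\<^bsub>S\<^esub> Q) $$ (k, k) = A $$ (k, k)"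
    "(P \<otimes>\<^bsub>S\<^esub> A \<otimes>\<^bsub>S\<^esub> Q) $$ (i, i) = A $$ (i, i) \<oplus> g \<otimes> A $$ (j, i)"
    "(P \<otimes>\<^bsub>S\<^esub> A \<otimes>\<^bsub>S\<^esub> Q) $$ (j, j) = A $$ (j, j) \<ominus> A $$ (j, i) \<otimes> g"
    "(P \<otimes>\<^bsub>S\<^esub> A \<otimes>\<^bsub>S\<^esub> Q) $$ (i, j)
      = A $$ (i, j) \<oplus> g \<otimes> A $$ (j, j) \<ominus> (A $$ (i, i) \<oplus> g \<otimes> A $$ (j, i)) \<otimes> g"
proof -
  define X where "X = mat n n (\<lambda>(k, l). if k = i \<and> l = j then g else \<zero>)"
  have X: "X \<in> carrier S" unfolding X_def using g by (intro mat_carrier) auto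
  have XB: "(X \<otimes>\<^bsub>S\<^esub> B) $$ (k, l) = (if k = i then g \<otimes> B $$ (j, l) else \<zero>)"
    if "B \<in> carrier S" "k < n" "l < n" for B k l
    using mult_entry_single[OF X that ij(2)] that g ij by (auto simp: X_def)
  have BX: "(B \<otimes>\<^bsub>S\<^esub> X) $$ (k, l) = (if l = j then B $$ (k, i) \<otimes> g else \<zero>)"
    if "B \<in> carrier S" "k < n" "l < n" for B k l
    using mult_entry_single[OF that(1) X that(2,3) ij(1)] that g ij by (auto simp: X_def)
  have XX: "X \<otimes>\<^bsub>S\<^esub> X = \<zero>\<^bsub>S\<^esub>"
    using X g ij by (intro matrix_eqI) (auto simp: XB, auto simp: X_def)
  let ?P = "\<one>\<^bsub>S\<^esub> \<oplus>\<^bsub>S\<^esub> X" and ?Q = "\<one>\<^bsub>S\<^esub> \<ominus>\<^bsub>S\<^esub> X"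
  have PQ: "?P \<in> carrier S" "?Q \<in> carrier S" "?P \<otimes>\<^bsub>S\<^esub> ?Q = \<one>\<^bsub>S\<^esub>" "?Q \<otimes>\<^bsub>S\<^esub> ?P = \<one>\<^bsub>S\<^esub>"
    using X XX
    by (auto simp: M.minus_eq M.l_distr M.r_distr M.l_minus M.r_minus M.a_assoc M.r_neg M.l_neg)
  let ?PA = "A \<oplus>\<^bsub>S\<^esub> X \<otimes>\<^bsub>S\<^esub> A"
  have PA: "?PA \<in> carrier S" "?P \<otimes>\<^bsub>S\<^esub> A = ?PA" using A X by (auto simp: M.l_distr)
  have "?P \<otimes>\<^bsub>S\<^esub> A \<otimes>\<^bsub>S\<^esub> ?Q = ?PA \<ominus>\<^bsub>S\<^esub> ?PA \<otimes>\<^bsub>S\<^esub> X"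
    unfolding PA(2) using PA(1) X by (simp add: M.minus_eq M.r_distr M.r_minus)
  then have entry: "(?P \<otimes>\<^bsub>S\<^esub> A \<otimes>\<^bsub>S\<^esub> ?Q) $$ (k, l)
      = ?PA $$ (k, l) \<ominus> (if l = j then ?PA $$ (k, i) \<otimes> g else \<zero>)" if "k < n" "l < n" for k l
    using that PA(1) X BX[OF PA(1)] by simp
  show ?thesis
    by (rule that[OF PQ]; (subst entry; use A X ij g in \<open>simp add: XB minus_eq\<close>))
qed

section \<open>Triangular matrices\<close>

text \<open>The weight \<open>w\<close> treats both triangular shapes at once: \<open>band int 0\<close> consists of the lower
  and \<open>band (\<lambda>i. - int i) 0\<close> of the upper triangular matrices.\<close>

definition band :: "(nat \<Rightarrow> int) \<Rightarrow> int \<Rightarrow> 'a mat set"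
  where "band w d = {A \<in> carrier S. \<forall>i<n. \<forall>j<n. w i - w j < d \<longrightarrow> A $$ (i, j) = \<zero>}"

lemma band_carrier: "A \<in> band w d \<Longrightarrow> A \<in> carrier S"
  by (simp add: band_def)

lemma band_entry: "A \<in> band w d \<Longrightarrow> i < n \<Longrightarrow> j < n \<Longrightarrow> w i - w j < d \<Longrightarrow> A $$ (i, j) = \<zero>"
  by (simp add: band_def)

lemma band_mono: "A \<in> band w d \<Longrightarrow> e \<le> d \<Longrightarrow> A \<in> band w e"
  by (auto simp: band_def)

lemma zero_in_band: "\<zero>\<^bsub>S\<^esub> \<in> band w d"
  by (simp add: band_def)

lemma band_add: "A \<in> band w d \<Longrightarrow> B \<in> band w d \<Longrightarrow> A \<oplus>\<^bsub>S\<^esub> B \<in> band w d"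
  by (simp add: band_def)

text \<open>The bands form a multiplicative filtration: \<open>w i - w j\<close> is the sum of
  \<open>w i - w k\<close> and \<open>w k - w j\<close>, so if it is below \<open>d + e\<close>, one
  summand is below its bound.\<close>

lemma band_mult:
  assumes "A \<in> band w d" "B \<in> band w e"
  shows "A \<otimes>\<^bsub>S\<^esub> B \<in> band w (d + e)"
proof -
  have "(A \<otimes>\<^bsub>S\<^esub> B) $$ (i, j) = \<zero>" if "i < n" "j < n" "w i - w j < d + e" for i j
  proof (rule mult_entry_zero[OF band_carrier[OF assms(1)] band_carrier[OF assms(2)] that(1,2)])
    fix k assume k: "k < n"
    have "w i - w k < d \<or> w k - w j < e" using that(3) by linarith
    then show "A $$ (i, k) = \<zero> \<or> B $$ (k, j) = \<zero>"
      using band_entry assms that(1,2) k by blast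
  qed
  moreover have "A \<otimes>\<^bsub>S\<^esub> B \<in> carrier S"
    using assms band_carrier by blast
  ultimately show ?thesis unfolding band_def by blast
qed

lemma one_in_band: "\<one>\<^bsub>S\<^esub> \<in> band w 0"
  by (simp add: band_def)

lemma band_pow: "A \<in> band w d \<Longrightarrow> A [^]\<^bsub>S\<^esub> k \<in> band w (int k * d)"
proof (induction k)
  case (Suc k)
  then have "A [^]\<^bsub>S\<^esub> k \<otimes>\<^bsub>S\<^esub> A \<in> band w (int k * d + d)"
    by (intro band_mult)
  moreover have "int k * d + d = int (Suc k) * d" by (simp add: algebra_simps)
  ultimately show ?case by (simp only: M.nat_pow_Suc)
qed (simp add: one_in_band)

lemma band_vanishes:
  assumes "A \<in> band w d" "\<And>i j. i < n \<Longrightarrow> j < n \<Longrightarrow> w i - w j < d"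
  shows "A = \<zero>\<^bsub>S\<^esub>"
  using band_carrier[OF assms(1)] band_entry[OF assms(1)] assms(2) by (intro matrix_eqI) auto

text \<open>By injectivity of \<open>w\<close>, for \<open>k \<noteq> i\<close> one of
  \<open>w i - w k\<close> and \<open>w k - w i\<close> is negative, so only \<open>k = i\<close>
  contributes to the sum.\<close>

lemma band_mult_diag:
  assumes "A \<in> band w 0" "B \<in> band w 0" "inj_on w {..<n}" "i < n"
  shows "(A \<otimes>\<^bsub>S\<^esub> B) $$ (i, i) = A $$ (i, i) \<otimes> B $$ (i, i)"
proof (rule mult_entry_single[OF band_carrier[OF assms(1)] band_carrier[OF assms(2)]])
  fix k assume k: "k < n" "k \<noteq> i"
  then have "w k \<noteq> w i" using assms(3,4) by (auto dest: inj_onD)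
  then have "w i - w k < 0 \<or> w k - w i < 0" by linarith
  then show "A $$ (i, k) = \<zero> \<or> B $$ (k, i) = \<zero>"
    using band_entry assms(1,2,4) k by blast
qed (use assms in auto)

lemma band_pow_diag:
  assumes "A \<in> band w 0" "inj_on w {..<n}" "i < n"
  shows "(A [^]\<^bsub>S\<^esub> k) $$ (i, i) = (A $$ (i, i)) [^] (k::nat)"
proof (induction k)
  case (Suc k)
  have "A [^]\<^bsub>S\<^esub> k \<in> band w 0" using band_pow[OF assms(1), of k] by simp
  then show ?case using Suc band_mult_diag[OF _ assms] by simp
qed (use assms in simp)

text \<open>Weights are integers and \<open>w\<close> is injective, so off the diagonal a difference
  below 1 is already negative.\<close>

lemma band_zero_diag:
  assumes "A \<in> band w 0" "inj_on w {..<n}" "\<And>i. i < n \<Longrightarrow> A $$ (i, i) = \<zero>"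
  shows "A \<in> band w 1"
proof -
  have "A $$ (i, j) = \<zero>" if "i < n" "j < n" "w i - w j < 1" for i j
  proof (cases "i = j")
    case False
    then have "w i \<noteq> w j" using assms(2) that by (auto dest: inj_onD)
    then show ?thesis using band_entry[OF assms(1) that(1,2)] that(3) by linarith
  qed (use assms(3) that in simp)
  then show ?thesis using band_carrier[OF assms(1)] unfolding band_def by blast
qed

text \<open>A common exponent kills the diagonal. The resulting power is strictly triangular, and
  its own powers move into ever deeper bands until they vanish.\<close>

lemma triangular_nilpotent:
  assumes w: "inj_on w {..<n}" "\<And>i j. i < n \<Longrightarrow> j < n \<Longrightarrow> w i - w j < int n"
    and A: "A \<in> band w 0" and d: "\<And>i. i < n \<Longrightarrow> A $$ (i, i) \<in> nilpotents R"
  shows "A \<in> nilpotents S"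
proof -
  have "\<forall>i. \<exists>k::nat. i < n \<longrightarrow> 1 \<le> k \<and> (A $$ (i, i)) [^] k = \<zero>"
    using d by (auto simp: nilpotents_def)
  then obtain f :: "nat \<Rightarrow> nat" where
    f: "\<And>i. i < n \<Longrightarrow> 1 \<le> f i \<and> (A $$ (i, i)) [^] f i = \<zero>" by metis
  \<comment> \<open>The product is a common multiple of the exponents, positive because each factor
    is.\<close>
  define K where "K = (\<Prod>i<n. f i)"
  have K: "1 \<le> K" unfolding K_def using f by (intro prod_ge_1) auto
  have Ac: "A \<in> carrier S" using band_carrier[OF A] .
  have "(A [^]\<^bsub>S\<^esub> K) $$ (i, i) = \<zero>" if i: "i < n" for i
  proof -
    obtain l where l: "K = f i * l"
      using dvd_prodI[of "{..<n}" i f] i by (auto simp: K_def dvd_def)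
    then have "(A $$ (i, i)) [^] K = ((A $$ (i, i)) [^] f i) [^] l"
      using Ac i by (simp add: nat_pow_pow)
    \<comment> \<open>Here \<open>l\<close> is nonzero because \<open>K\<close> is positive, so
      \<open>\<zero> [^] l\<close> is \<open>\<zero>\<close>.\<close>
    also have "\<dots> = \<zero>" using l K f[OF i] by (simp add: nat_pow_zero)
    finally show ?thesis using band_pow_diag[OF A w(1) i] by simp
  qed
  then have "A [^]\<^bsub>S\<^esub> K \<in> band w 1"
    using band_pow[OF A, of K] w(1) by (intro band_zero_diag) auto
  then have "(A [^]\<^bsub>S\<^esub> K) [^]\<^bsub>S\<^esub> Suc n \<in> band w (int (Suc n))"
    using band_pow[of "A [^]\<^bsub>S\<^esub> K" w 1 "Suc n"] by simp
  then have "A [^]\<^bsub>S\<^esub> (K * Suc n) = \<zero>\<^bsub>S\<^esub>"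
    unfolding M.nat_pow_pow[OF Ac] using w(2) by (intro band_vanishes) (auto, fastforce)
  then show ?thesis
    unfolding nilpotents_def using Ac K by (intro CollectI conjI exI[of _ "K * Suc n"]) auto
qed

text \<open>Entrywise, adding up \<open>k\<close> copies of \<open>A\<close> is multiplication by
  the image of \<open>k\<close> in \<open>R\<close>.\<close>

lemma char_matrix_ring:
  assumes "add_pow R (c::nat) \<one> = \<zero>" "A \<in> carrier S"
  shows "add_pow S c A = \<zero>\<^bsub>S\<^esub>"
proof -
  have e: "(add_pow S k A) $$ (i, j) = add_pow R k \<one> \<otimes> A $$ (i, j)"
    if "i < n" "j < n" for i j and k :: nat
    using that assms(2) by (induction k) (auto simp: l_distr)
  then show ?thesis
    using assms by (intro matrix_eqI) auto
qed

text \<open>The binomial expansion to first order. The higher terms contain at least two factors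
  from \<open>band w d\<close>, and \<open>d + d \<ge> d + 1\<close>.\<close>

lemma unipotent_pow:
  assumes N: "N \<in> band w d" and d: "1 \<le> d"
  shows "\<exists>E\<in>band w (d + 1). (\<one>\<^bsub>S\<^esub> \<oplus>\<^bsub>S\<^esub> N) [^]\<^bsub>S\<^esub> (k::nat) = \<one>\<^bsub>S\<^esub> \<oplus>\<^bsub>S\<^esub> add_pow S k N \<oplus>\<^bsub>S\<^esub> E"
proof (induction k)
  case 0
  then show ?case by (intro bexI[of _ "\<zero>\<^bsub>S\<^esub>"] zero_in_band) simp
next
  case (Suc k)
  then obtain E where E: "E \<in> band w (d + 1)"
    "(\<one>\<^bsub>S\<^esub> \<oplus>\<^bsub>S\<^esub> N) [^]\<^bsub>S\<^esub> k = \<one>\<^bsub>S\<^esub> \<oplus>\<^bsub>S\<^esub> add_pow S k N \<oplus>\<^bsub>S\<^esub> E" by blast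
  have c: "N \<in> carrier S" "E \<in> carrier S" "add_pow S k N \<in> carrier S"
    using N E(1) by (auto dest: band_carrier)
  have kN: "add_pow S k N \<in> band w d"
    by (induction k) (auto simp: zero_in_band intro: band_add N)
  let ?E = "E \<oplus>\<^bsub>S\<^esub> (add_pow S k N \<otimes>\<^bsub>S\<^esub> N \<oplus>\<^bsub>S\<^esub> E \<otimes>\<^bsub>S\<^esub> N)"
  have "(\<one>\<^bsub>S\<^esub> \<oplus>\<^bsub>S\<^esub> N) [^]\<^bsub>S\<^esub> Suc k = \<one>\<^bsub>S\<^esub> \<oplus>\<^bsub>S\<^esub> add_pow S (Suc k) N \<oplus>\<^bsub>S\<^esub> ?E"
    using c E(2) by (simp add: M.l_distr M.r_distr M.a_ac)
  moreover have "?E \<in> band w (d + 1)"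
    using E(1) band_mult[OF kN N] band_mult[OF E(1) N] d by (intro band_add) (auto elim: band_mono)
  ultimately show ?case by blast
qed

text \<open>Since \<open>c N = 0\<close>, each \<open>c\<close>-th power pushes the nilpotent part one band deeper.\<close>

lemma unipotent_torsion:
  assumes w: "\<And>i j. i < n \<Longrightarrow> j < n \<Longrightarrow> w i - w j < int n"
    and c: "1 \<le> (c::nat)" "add_pow R c \<one> = \<zero>" and N: "N \<in> band w 1"
  shows "\<exists>k::nat. 1 \<le> k \<and> (\<one>\<^bsub>S\<^esub> \<oplus>\<^bsub>S\<^esub> N) [^]\<^bsub>S\<^esub> k = \<one>\<^bsub>S\<^esub>"
proof -
  have Nc: "N \<in> carrier S" using band_carrier[OF N] .
  have "\<exists>k E. 1 \<le> k \<and> E \<in> band w (1 + int e) \<and> (\<one>\<^bsub>S\<^esub> \<oplus>\<^bsub>S\<^esub> N) [^]\<^bsub>S\<^esub> (k::nat) = \<one>\<^bsub>S\<^esub> \<oplus>\<^bsub>S\<^esub> E" for e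
  proof (induction e)
    case 0
    then show ?case using N Nc by (intro exI[of _ 1] exI[of _ N]) auto
  next
    case (Suc e)
    then obtain k E where E: "1 \<le> k" "E \<in> band w (1 + int e)"
      "(\<one>\<^bsub>S\<^esub> \<oplus>\<^bsub>S\<^esub> N) [^]\<^bsub>S\<^esub> (k::nat) = \<one>\<^bsub>S\<^esub> \<oplus>\<^bsub>S\<^esub> E" by blast
    have Ec: "E \<in> carrier S" using band_carrier[OF E(2)] .
    obtain E' where E': "E' \<in> band w (1 + int e + 1)"
      "(\<one>\<^bsub>S\<^esub> \<oplus>\<^bsub>S\<^esub> E) [^]\<^bsub>S\<^esub> c = \<one>\<^bsub>S\<^esub> \<oplus>\<^bsub>S\<^esub> add_pow S c E \<oplus>\<^bsub>S\<^esub> E'"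
      using unipotent_pow[OF E(2)] by auto
    have "(\<one>\<^bsub>S\<^esub> \<oplus>\<^bsub>S\<^esub> N) [^]\<^bsub>S\<^esub> (k * c) = \<one>\<^bsub>S\<^esub> \<oplus>\<^bsub>S\<^esub> E'"
      using E(3) E'(2) char_matrix_ring[OF c(2) Ec] Nc
      by (simp add: M.nat_pow_pow[symmetric])
    moreover have "1 \<le> k * c" using E(1) c(1) by simp
    moreover have "E' \<in> band w (1 + int (Suc e))" using E'(1) by (simp add: add_ac)
    ultimately show ?case by blast
  qed
  from this[of n] obtain k E where E: "1 \<le> k" "E \<in> band w (1 + int n)"
    "(\<one>\<^bsub>S\<^esub> \<oplus>\<^bsub>S\<^esub> N) [^]\<^bsub>S\<^esub> (k::nat) = \<one>\<^bsub>S\<^esub> \<oplus>\<^bsub>S\<^esub> E" by blast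
  have "E = \<zero>\<^bsub>S\<^esub>"
  proof (rule band_vanishes[OF E(2)])
    show "w i - w j < 1 + int n" if "i < n" "j < n" for i j
      using w[OF that] by linarith
  qed
  then show ?thesis using E by auto
qed

text \<open>A common exponent turns every diagonal entry into \<open>\<one>\<close>. That power of
  \<open>A\<close> is \<open>1 + N\<close> with \<open>N\<close> strictly triangular, so the
  unipotent case applies.\<close>

lemma triangular_torsion:
  assumes w: "inj_on w {..<n}" "\<And>i j. i < n \<Longrightarrow> j < n \<Longrightarrow> w i - w j < int n"
    and c: "1 \<le> (c::nat)" "add_pow R c \<one> = \<zero>"
    and A: "A \<in> band w 0" and d: "\<And>i. i < n \<Longrightarrow> A $$ (i, i) \<in> torsion_units R"
  shows "A \<in> torsion_units S"
proof -
  have "\<forall>i. \<exists>k::nat. i < n \<longrightarrow> 1 \<le> k \<and> (A $$ (i, i)) [^] k = \<one>"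
    using d by (auto simp: torsion_units_def)
  then obtain f :: "nat \<Rightarrow> nat" where
    f: "\<And>i. i < n \<Longrightarrow> 1 \<le> f i \<and> (A $$ (i, i)) [^] f i = \<one>" by metis
  define K where "K = (\<Prod>i<n. f i)"
  have K: "1 \<le> K" unfolding K_def using f by (intro prod_ge_1) auto
  have Ac: "A \<in> carrier S" using band_carrier[OF A] .
  let ?N = "A [^]\<^bsub>S\<^esub> K \<ominus>\<^bsub>S\<^esub> \<one>\<^bsub>S\<^esub>"
  have AK: "A [^]\<^bsub>S\<^esub> K \<in> band w 0" "A [^]\<^bsub>S\<^esub> K \<in> carrier S"
    using band_pow[OF A, of K] Ac by auto
  have "(A [^]\<^bsub>S\<^esub> K) $$ (i, i) = \<one>" if i: "i < n" for i
  proof -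
    obtain l where l: "K = f i * l"
      using dvd_prodI[of "{..<n}" i f] i by (auto simp: K_def dvd_def)
    then have "(A $$ (i, i)) [^] K = ((A $$ (i, i)) [^] f i) [^] l"
      using Ac i by (simp add: nat_pow_pow)
    also have "\<dots> = \<one>" using f[OF i] by simp
    finally show ?thesis using band_pow_diag[OF A w(1) i] by simp
  qed
  then have "?N \<in> band w 1"
    using AK w(1) by (intro band_zero_diag) (auto simp: band_def minus_eq r_neg)
  then obtain k :: nat where "1 \<le> k" "(\<one>\<^bsub>S\<^esub> \<oplus>\<^bsub>S\<^esub> ?N) [^]\<^bsub>S\<^esub> k = \<one>\<^bsub>S\<^esub>"
    using unipotent_torsion[of w c ?N, OF w(2) c] by blast
  moreover have "\<one>\<^bsub>S\<^esub> \<oplus>\<^bsub>S\<^esub> ?N = A [^]\<^bsub>S\<^esub> K \<oplus>\<^bsub>S\<^esub> (\<one>\<^bsub>S\<^esub> \<oplus>\<^bsub>S\<^esub> \<ominus>\<^bsub>S\<^esub> \<one>\<^bsub>S\<^esub>)"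
    using AK(2) by (simp add: M.minus_eq M.a_lcomm)
  then have "\<one>\<^bsub>S\<^esub> \<oplus>\<^bsub>S\<^esub> ?N = A [^]\<^bsub>S\<^esub> K"
    using AK(2) by (simp add: M.r_neg)
  ultimately have "A [^]\<^bsub>S\<^esub> (K * k) = \<one>\<^bsub>S\<^esub>" "1 \<le> K * k"
    using Ac K by (simp_all add: M.nat_pow_pow)
  then show ?thesis using Ac by (intro M.torsion_unitsI)
qed

lemma diagonal_sums_imp_sum:
  assumes c: "1 \<le> (c::nat)" "add_pow R c \<one> = \<zero>"
    and A: "A \<in> carrier S"
    and d: "\<And>i. i < n \<Longrightarrow> A $$ (i, i) \<in> torsion_units R <+>\<^bsub>R\<^esub> nilpotents R"
  shows "A \<in> torsion_units S <+>\<^bsub>S\<^esub> nilpotents S"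
proof -
  have "\<forall>i. \<exists>u q. i < n \<longrightarrow> u \<in> torsion_units R \<and> q \<in> nilpotents R \<and> A $$ (i, i) = u \<oplus> q"
    using d by (fastforce simp: set_add_def')
  then obtain u q where uq: "\<And>i. i < n \<Longrightarrow>
      u i \<in> torsion_units R \<and> q i \<in> nilpotents R \<and> A $$ (i, i) = u i \<oplus> q i"
    by metis
  have cl: "u i \<in> carrier R" "q i \<in> carrier R" if "i < n" for i
    using uq[OF that] by (auto simp: torsion_units_def nilpotents_def)
  \<comment> \<open>Entries off the diagonal go to the summand of matching shape, since membership
    in the torsion units or nilpotents is decided on the diagonal of a triangular matrix.\<close>
  let ?L = "mat n n (\<lambda>(i, j). if i = j then u i else if j < i then A $$ (i, j) else \<zero>)"
  let ?U = "mat n n (\<lambda>(i, j). if i = j then q i else if i < j then A $$ (i, j) else \<zero>)"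
  have LU: "?L \<in> carrier S" "?U \<in> carrier S"
    using A cl by (auto intro!: mat_carrier)
  have "?L \<in> torsion_units S"
  proof (rule triangular_torsion[OF _ _ c])
    show "?L \<in> band int 0" using LU(1) by (simp add: band_def)
  qed (use uq in auto)
  moreover have "?U \<in> nilpotents S"
  proof (rule triangular_nilpotent)
    show "?U \<in> band (\<lambda>i. - int i) 0" using LU(2) by (simp add: band_def)
  qed (use uq in \<open>auto simp: inj_on_def\<close>)
  moreover have "A = ?L \<oplus>\<^bsub>S\<^esub> ?U"
    using A LU uq by (intro matrix_eqI) auto
  ultimately show ?thesis by (auto simp: set_add_def')
qed

section \<open>Conjugation by transvections\<close>

text \<open>Call an entry good if it lies outside \<open>J(R)\<close>. The hypothesis
  \<open>base\<close> settles matrices with a good diagonal. The others are reduced to it by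
  conjugation: \<open>step'\<close> and \<open>step\<close> repair one diagonal entry while keeping
  another good, and \<open>diag\<close> iterates this.\<close>

lemma make_diagonal_entries_nonradical:
  assumes c: "c \<in> carrier R" "\<And>x. x \<in> carrier R \<Longrightarrow> x \<otimes> c = c \<otimes> x"
    and z: "z \<in> carrier R" "z \<otimes> c = \<one>" and z': "z' \<in> carrier R" "z' \<otimes> (\<one> \<ominus> c) = \<one>"
    and base: "\<And>A. A \<in> carrier S \<Longrightarrow> (\<And>i. i < n \<Longrightarrow> A $$ (i, i) \<notin> jacobson_radical R)
        \<Longrightarrow> A \<in> torsion_units S <+>\<^bsub>S\<^esub> nilpotents S"
    and A: "A \<in> carrier S" "i < n" "j < n" "A $$ (i, j) \<notin> jacobson_radical R"
  shows "A \<in> torsion_units S <+>\<^bsub>S\<^esub> nilpotents S"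
proof -
  let ?J = "jacobson_radical R" and ?G = "torsion_units S <+>\<^bsub>S\<^esub> nilpotents S"
  interpret J: left_ideal ?J R by (rule jacobson_left_ideal)
  note conj = M.conjugate_torsion_plus_nilpotent
  \<comment> \<open>One of \<open>g = \<one>\<close> and \<open>g = c\<close> works: if both sums
    lay in the radical, so would their difference \<open>(\<one> \<ominus> c) \<otimes> b\<close>,
    hence \<open>b\<close>, hence \<open>a\<close>. Both candidates are central and left
    invertible.\<close>
  have scalar: "\<exists>g\<in>carrier R. a \<oplus> g \<otimes> b \<notin> ?J \<and> (\<forall>x\<in>carrier R. x \<otimes> g = g \<otimes> x)
      \<and> (\<forall>x\<in>carrier R. g \<otimes> x \<in> ?J \<longleftrightarrow> x \<in> ?J)"
    if ab: "a \<in> carrier R" "b \<in> carrier R" "a \<notin> ?J" for a b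
  proof (cases "a \<oplus> b \<in> ?J")
    case True
    have "a \<oplus> c \<otimes> b \<notin> ?J"
    proof
      assume "a \<oplus> c \<otimes> b \<in> ?J"
      then have "(a \<oplus> b) \<ominus> (a \<oplus> c \<otimes> b) \<in> ?J" using J.diff_closed_ideal[OF True] by blast
      moreover have "(a \<oplus> b) \<ominus> (a \<oplus> c \<otimes> b) = (a \<oplus> \<ominus> a) \<oplus> (b \<oplus> \<ominus> (c \<otimes> b))"
        using ab c(1) by (simp add: minus_eq minus_add a_ac)
      then have "(a \<oplus> b) \<ominus> (a \<oplus> c \<otimes> b) = (\<one> \<ominus> c) \<otimes> b"
        using ab c(1) by (simp add: minus_eq l_distr l_minus r_neg)
      ultimately have "b \<in> ?J"
        using J.left_unit_mult_in_iff[OF z'(1) _ z'(2)] ab c(1) by simp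
      then show False
        using True ab J.add_in_iff[of b a] by (simp add: a_comm)
    qed
    then show ?thesis
      using c J.left_unit_mult_in_iff[OF z(1) c(1) z(2)] by blast
  next
    case False
    then show ?thesis using ab by (intro bexI[of _ \<one>]) auto
  qed
  \<comment> \<open>With a good entry at \<open>(i, j)\<close>, conjugate by
    \<open>1 + g E_ji\<close>. The bad entry at \<open>(j, j)\<close> gains \<open>g\<close> times
    the good one and becomes good, and \<open>scalar\<close>, applied to the negative of the entry
    at \<open>(i, j)\<close>, keeps \<open>(i, i)\<close> good. \<open>IH\<close> says how to finish
    once both are good.\<close>
  have step': "B \<in> ?G"
    if B: "B \<in> carrier S" and ij: "i < n" "j < n" "i \<noteq> j"
      and d: "B $$ (i, i) \<notin> ?J" "B $$ (j, j) \<in> ?J" "B $$ (i, j) \<notin> ?J"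
      and IH: "\<And>C. C \<in> carrier S \<Longrightarrow> C $$ (i, i) \<notin> ?J \<Longrightarrow> C $$ (j, j) \<notin> ?J \<Longrightarrow>
        (\<And>k. k < n \<Longrightarrow> k \<noteq> i \<Longrightarrow> k \<noteq> j \<Longrightarrow> C $$ (k, k) = B $$ (k, k)) \<Longrightarrow> C \<in> ?G"
    for B i j
  proof -
    obtain g where g: "g \<in> carrier R" "B $$ (i, i) \<oplus> g \<otimes> \<ominus> (B $$ (i, j)) \<notin> ?J"
      "\<And>x. x \<in> carrier R \<Longrightarrow> x \<otimes> g = g \<otimes> x" "\<And>x. x \<in> carrier R \<Longrightarrow> g \<otimes> x \<in> ?J \<longleftrightarrow> x \<in> ?J"
      using scalar[OF entry_closed[OF B ij(1,1)] a_inv_closed[OF entry_closed[OF B ij(1,2)]] d(1)]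
      by blast
    obtain P Q where PQ: "P \<in> carrier S" "Q \<in> carrier S" "P \<otimes>\<^bsub>S\<^esub> Q = \<one>\<^bsub>S\<^esub>" "Q \<otimes>\<^bsub>S\<^esub> P = \<one>\<^bsub>S\<^esub>"
      and C: "\<And>k. k < n \<Longrightarrow> k \<noteq> j \<Longrightarrow> k \<noteq> i \<Longrightarrow> (P \<otimes>\<^bsub>S\<^esub> B \<otimes>\<^bsub>S\<^esub> Q) $$ (k, k) = B $$ (k, k)"
      "(P \<otimes>\<^bsub>S\<^esub> B \<otimes>\<^bsub>S\<^esub> Q) $$ (j, j) = B $$ (j, j) \<oplus> g \<otimes> B $$ (i, j)"
      "(P \<otimes>\<^bsub>S\<^esub> B \<otimes>\<^bsub>S\<^esub> Q) $$ (i, i) = B $$ (i, i) \<ominus> B $$ (i, j) \<otimes> g"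
      by (rule transvection[OF B ij(2,1) ij(3)[symmetric] g(1)]) (rule that; assumption)
    have "P \<otimes>\<^bsub>S\<^esub> B \<otimes>\<^bsub>S\<^esub> Q \<in> ?G"
    proof (rule IH)
      show "(P \<otimes>\<^bsub>S\<^esub> B \<otimes>\<^bsub>S\<^esub> Q) $$ (i, i) \<notin> ?J"
        using C(3) g(1-3) B ij by (simp add: minus_eq r_minus)
      show "(P \<otimes>\<^bsub>S\<^esub> B \<otimes>\<^bsub>S\<^esub> Q) $$ (j, j) \<notin> ?J"
        using C(2) g(1,4) d(2,3) B ij J.add_in_iff[OF d(2)] by simp
    qed (use PQ B C(1) in auto)
    then show ?thesis using conj PQ B by blast
  qed
  \<comment> \<open>If the entry at \<open>(i, j)\<close> is radical, first conjugate by
    \<open>1 + g E_ij\<close>. Either this already repairs \<open>(j, j)\<close>, or it creates a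
    good entry at \<open>(i, j)\<close> and \<open>step'\<close> takes over.\<close>
  have step: "B \<in> ?G"
    if B: "B \<in> carrier S" and ij: "i < n" "j < n" "i \<noteq> j"
      and d: "B $$ (i, i) \<notin> ?J" "B $$ (j, j) \<in> ?J"
      and IH: "\<And>C. C \<in> carrier S \<Longrightarrow> C $$ (i, i) \<notin> ?J \<Longrightarrow> C $$ (j, j) \<notin> ?J \<Longrightarrow>
        (\<And>k. k < n \<Longrightarrow> k \<noteq> i \<Longrightarrow> k \<noteq> j \<Longrightarrow> C $$ (k, k) = B $$ (k, k)) \<Longrightarrow> C \<in> ?G"
    for B i j
  proof (cases "B $$ (i, j) \<in> ?J")
    case False
    then show ?thesis using step'[OF B ij d] IH by blast
  next
    case True
    obtain g where g: "g \<in> carrier R" "B $$ (i, i) \<oplus> g \<otimes> B $$ (j, i) \<notin> ?J"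
      "\<And>x. x \<in> carrier R \<Longrightarrow> x \<otimes> g = g \<otimes> x" "\<And>x. x \<in> carrier R \<Longrightarrow> g \<otimes> x \<in> ?J \<longleftrightarrow> x \<in> ?J"
      using scalar[OF entry_closed[OF B ij(1,1)] entry_closed[OF B ij(2,1)] d(1)] by blast
    obtain P Q where PQ: "P \<in> carrier S" "Q \<in> carrier S" "P \<otimes>\<^bsub>S\<^esub> Q = \<one>\<^bsub>S\<^esub>" "Q \<otimes>\<^bsub>S\<^esub> P = \<one>\<^bsub>S\<^esub>"
      and C: "\<And>k. k < n \<Longrightarrow> k \<noteq> i \<Longrightarrow> k \<noteq> j \<Longrightarrow> (P \<otimes>\<^bsub>S\<^esub> B \<otimes>\<^bsub>S\<^esub> Q) $$ (k, k) = B $$ (k, k)"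
      "(P \<otimes>\<^bsub>S\<^esub> B \<otimes>\<^bsub>S\<^esub> Q) $$ (i, i) = B $$ (i, i) \<oplus> g \<otimes> B $$ (j, i)"
      "(P \<otimes>\<^bsub>S\<^esub> B \<otimes>\<^bsub>S\<^esub> Q) $$ (i, j)
        = B $$ (i, j) \<oplus> g \<otimes> B $$ (j, j) \<ominus> (B $$ (i, i) \<oplus> g \<otimes> B $$ (j, i)) \<otimes> g"
      by (rule transvection[OF B ij g(1)]) (rule that; assumption)
    let ?C = "P \<otimes>\<^bsub>S\<^esub> B \<otimes>\<^bsub>S\<^esub> Q"
    have Cc: "?C \<in> carrier S" using PQ B by simp
    have Ci: "?C $$ (i, i) \<notin> ?J" using C(2) g(2) by simp
    have "?C \<in> ?G"
    proof (cases "?C $$ (j, j) \<in> ?J")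
      case False
      then show ?thesis using IH[OF Cc Ci] C(1) by blast
    next
      case Cj: True
      \<comment> \<open>Modulo the radical this entry is minus the new entry at
        \<open>(i, i)\<close> times \<open>g\<close>; the former is good, and the central left
        invertible \<open>g\<close> preserves that.\<close>
      have "?C $$ (i, j) \<notin> ?J"
      proof
        assume a: "?C $$ (i, j) \<in> ?J"
        have "B $$ (i, j) \<oplus> g \<otimes> B $$ (j, j) \<in> ?J"
          using True d(2) g(4) B ij by (intro J.a_closed) auto
        then have "\<ominus> (?C $$ (i, i) \<otimes> g) \<in> ?J"
          using a unfolding C(3) C(2)[symmetric] minus_eq
          using J.add_in_iff Cc ij g(1) by simp
        then have "\<ominus> (\<ominus> (?C $$ (i, i) \<otimes> g)) \<in> ?J" by (rule J.minus_closed_ideal)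
        then show False using Ci g(1,3,4) Cc ij by simp
      qed
      then show ?thesis
      proof (rule step'[OF Cc ij Ci Cj])
        fix D assume "D \<in> carrier S" "D $$ (i, i) \<notin> ?J" "D $$ (j, j) \<notin> ?J"
          and "\<And>k. k < n \<Longrightarrow> k \<noteq> i \<Longrightarrow> k \<noteq> j \<Longrightarrow> D $$ (k, k) = ?C $$ (k, k)"
        then show "D \<in> ?G" using IH[of D] C(1) by metis
      qed
    qed
    then show ?thesis using conj PQ B by blast
  qed
  \<comment> \<open>Induction on the number of bad diagonal entries: \<open>j\<close> leaves the set
    of bad indices and no index enters it.\<close>
  have diag: "B \<in> ?G" if "B \<in> carrier S" "i < n" "B $$ (i, i) \<notin> ?J" for B i
    using that
  proof (induction "card {k. k < n \<and> B $$ (k, k) \<in> ?J}" arbitrary: B rule: less_induct)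
    case less
    show ?case
    proof (cases "\<exists>j<n. B $$ (j, j) \<in> ?J")
      case False
      then show ?thesis using base less.prems by blast
    next
      case True
      then obtain j where j: "j < n" "B $$ (j, j) \<in> ?J" by blast
      then have "i \<noteq> j" using less.prems by blast
      show ?thesis
      proof (rule step[OF less.prems(1,2) j(1) \<open>i \<noteq> j\<close> less.prems(3) j(2)])
        fix C assume C: "C \<in> carrier S" "C $$ (i, i) \<notin> ?J" "C $$ (j, j) \<notin> ?J"
          "\<And>k. k < n \<Longrightarrow> k \<noteq> i \<Longrightarrow> k \<noteq> j \<Longrightarrow> C $$ (k, k) = B $$ (k, k)"
        have "{k. k < n \<and> C $$ (k, k) \<in> ?J} \<subseteq> {k. k < n \<and> B $$ (k, k) \<in> ?J}"
        proof clarify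
          fix k assume "k < n" "C $$ (k, k) \<in> ?J"
          then show "B $$ (k, k) \<in> ?J" using C(2-4) by metis
        qed
        moreover have "j \<in> {k. k < n \<and> B $$ (k, k) \<in> ?J} - {k. k < n \<and> C $$ (k, k) \<in> ?J}"
          using j C(3) by blast
        ultimately have "card {k. k < n \<and> C $$ (k, k) \<in> ?J} < card {k. k < n \<and> B $$ (k, k) \<in> ?J}"
          by (intro psubset_card_mono) auto
        then show "C \<in> ?G" by (rule less.hyps[OF _ C(1) less.prems(2) C(2)])
      qed
    qed
  qed
  show ?thesis
  proof (cases "\<exists>k<n. A $$ (k, k) \<notin> ?J")
    case True
    then obtain k where "k < n" "A $$ (k, k) \<notin> ?J" by blast
    then show ?thesis by (rule diag[OF A(1)])
  next
    case False
    then have J: "A $$ (i, i) \<in> ?J" "A $$ (j, j) \<in> ?J" using A(2,3) by blast+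
    then have "i \<noteq> j" using A(4) by blast
    \<comment> \<open>With the whole diagonal in the radical, conjugating by \<open>1 + E_ji\<close>
      adds the good entry at \<open>(i, j)\<close> to the one at \<open>(j, j)\<close> and produces
      a first good diagonal entry.\<close>
    obtain P Q where PQ: "P \<in> carrier S" "Q \<in> carrier S" "P \<otimes>\<^bsub>S\<^esub> Q = \<one>\<^bsub>S\<^esub>" "Q \<otimes>\<^bsub>S\<^esub> P = \<one>\<^bsub>S\<^esub>"
      and C: "(P \<otimes>\<^bsub>S\<^esub> A \<otimes>\<^bsub>S\<^esub> Q) $$ (j, j) = A $$ (j, j) \<oplus> \<one> \<otimes> A $$ (i, j)"
      by (rule transvection[OF A(1,3,2) \<open>i \<noteq> j\<close>[symmetric] one_closed]) (rule that; assumption)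
    have "(P \<otimes>\<^bsub>S\<^esub> A \<otimes>\<^bsub>S\<^esub> Q) $$ (j, j) \<notin> ?J"
      unfolding C l_one[OF entry_closed[OF A(1-3)]]
      using A(4) J.add_in_iff[OF J(2) entry_closed[OF A(1-3)]] by blast
    then have "P \<otimes>\<^bsub>S\<^esub> A \<otimes>\<^bsub>S\<^esub> Q \<in> ?G"
      by (intro diag[of _ j] A(3) M.m_closed PQ(1,2) A(1))
    then show ?thesis by (rule conj[OF PQ A(1)])
  qed
qed

end

section \<open>Algebras over a field\<close>

lemma (in assoc_algebra) scalar_left_inverse:
  assumes "field F" "a \<in> carrier F" "a \<noteq> \<zero>\<^bsub>F\<^esub>"
  shows "\<exists>z\<in>carrier A. z \<otimes> (a \<odot> \<one>) = \<one>"
proof -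
  interpret F: field F by fact
  have b: "inv\<^bsub>F\<^esub> a \<in> carrier F" "inv\<^bsub>F\<^esub> a \<otimes>\<^bsub>F\<^esub> a = \<one>\<^bsub>F\<^esub>"
    using F.field_Units assms(2,3) by auto
  then have "(inv\<^bsub>F\<^esub> a \<odot> \<one>) \<otimes> (a \<odot> \<one>) = \<one>"
    using assms(2) by (simp add: smult_mult_left smult_assoc1[symmetric])
  then show ?thesis using b by auto
qed

lemma (in assoc_algebra) add_pow_one:
  "add_pow A (k::nat) \<one> = add_pow F k \<one>\<^bsub>F\<^esub> \<odot> \<one>"
  by (induction k) (auto simp: smult_l_distr)

theorem theorem2p20:
  fixes F :: "('f, 'm) ring_scheme" and R :: "('f, 'r, 'k) module_scheme" and n :: nat
  assumes "field F"
    and "infinite (carrier F) \<or> 3 \<le> card (carrier F)"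
    and "assoc_algebra F R"
    and "generalized_t_fine R"
    and "1 \<le> n"
  shows "generalized_t_fine (matrix_ring n R)"
proof -
  interpret F: field F by fact
  interpret R: assoc_algebra F R by fact
  interpret R: generalized_t_fine R by fact
  interpret square_matrices R n ..
  \<comment> \<open>The third scalar. As \<open>card\<close> of an infinite set is 0, infinite
    fields form a separate alternative of the assumption; either alternative contradicts a carrier
    of at most two elements.\<close>
  have "\<exists>t\<in>carrier F. t \<notin> {\<zero>\<^bsub>F\<^esub>, \<one>\<^bsub>F\<^esub>}"
  proof (rule ccontr)
    assume "\<not> ?thesis"
    then have "carrier F \<subseteq> {\<zero>\<^bsub>F\<^esub>, \<one>\<^bsub>F\<^esub>}" by blast
    then have "finite (carrier F)" "card (carrier F) \<le> 2"
      using finite_subset card_mono[of "{\<zero>\<^bsub>F\<^esub>, \<one>\<^bsub>F\<^esub>}" "carrier F"] by auto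
    then show False using assms(2) by simp
  qed
  then obtain t where t: "t \<in> carrier F" "t \<noteq> \<zero>\<^bsub>F\<^esub>" "t \<noteq> \<one>\<^bsub>F\<^esub>" by blast
  \<comment> \<open>The image of \<open>t\<close> in the centre of \<open>R\<close>. Since
    \<open>t\<close> is neither 0 nor 1, both \<open>c\<close> and \<open>1 - c\<close> are images
    of nonzero scalars and hence left invertible.\<close>
  define c where "c = t \<odot>\<^bsub>R\<^esub> \<one>\<^bsub>R\<^esub>"
  have c: "c \<in> carrier R" "\<And>x. x \<in> carrier R \<Longrightarrow> x \<otimes>\<^bsub>R\<^esub> c = c \<otimes>\<^bsub>R\<^esub> x"
    using t by (auto simp: c_def R.smult_mult_left R.smult_mult_right)
  obtain z where z: "z \<in> carrier R" "z \<otimes>\<^bsub>R\<^esub> c = \<one>\<^bsub>R\<^esub>"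
    using R.scalar_left_inverse[OF assms(1) t(1,2)] by (auto simp: c_def)
  have "\<one>\<^bsub>F\<^esub> \<ominus>\<^bsub>F\<^esub> t \<noteq> \<zero>\<^bsub>F\<^esub>"
    using F.minus_zero_imp_eq[OF F.one_closed t(1)] t(3) by metis
  moreover have "(\<one>\<^bsub>F\<^esub> \<ominus>\<^bsub>F\<^esub> t) \<odot>\<^bsub>R\<^esub> \<one>\<^bsub>R\<^esub> = \<one>\<^bsub>R\<^esub> \<ominus>\<^bsub>R\<^esub> c"
    using t by (simp add: c_def a_minus_def R.smult_l_distr R.smult_l_minus)
  ultimately obtain z' where z': "z' \<in> carrier R" "z' \<otimes>\<^bsub>R\<^esub> (\<one>\<^bsub>R\<^esub> \<ominus>\<^bsub>R\<^esub> c) = \<one>\<^bsub>R\<^esub>"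
    using R.scalar_left_inverse[OF assms(1), of "\<one>\<^bsub>F\<^esub> \<ominus>\<^bsub>F\<^esub> t"] t by auto
  \<comment> \<open>Integer multiples of one in \<open>R\<close> come from the prime field of
    \<open>F\<close>, so the nonzero ones are left invertible.\<close>
  have "\<exists>z\<in>carrier R. z \<otimes>\<^bsub>R\<^esub> add_pow R k \<one>\<^bsub>R\<^esub> = \<one>\<^bsub>R\<^esub>" if "add_pow R k \<one>\<^bsub>R\<^esub> \<noteq> \<zero>\<^bsub>R\<^esub>" for k :: nat
  proof -
    have "add_pow F k \<one>\<^bsub>F\<^esub> \<noteq> \<zero>\<^bsub>F\<^esub>" using that by (auto simp: R.add_pow_one)
    then show ?thesis
      unfolding R.add_pow_one by (intro R.scalar_left_inverse[OF assms(1)]) auto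
  qed
  then obtain k :: nat where k: "1 \<le> k" "add_pow R k \<one>\<^bsub>R\<^esub> = \<zero>\<^bsub>R\<^esub>"
    using R.finite_characteristic by blast
  \<comment> \<open>Here \<open>1 \<le> n\<close> matters: it provides the index 0, so that the
    matrix ring is nontrivial.\<close>
  have "\<one>\<^bsub>S\<^esub> $$ (0, 0) \<noteq> \<zero>\<^bsub>S\<^esub> $$ (0, 0)"
    using assms(5) R.one_not_zero by simp
  then have "\<one>\<^bsub>S\<^esub> \<noteq> \<zero>\<^bsub>S\<^esub>" by metis
  then have sub: "torsion_units S <+>\<^bsub>S\<^esub> nilpotents S \<subseteq> carrier S - jacobson_radical S"
    using M.torsion_plus_nilpotent_not_jacobson
    by (auto simp: set_add_def' torsion_units_def nilpotents_def)
  have "A \<in> torsion_units S <+>\<^bsub>S\<^esub> nilpotents S"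
    if A: "A \<in> carrier S" "A \<notin> jacobson_radical S" for A
  proof -
    obtain i j where ij: "i < n" "j < n" "A $$ (i, j) \<notin> jacobson_radical R"
      using entries_in_jacobson[OF A(1)] A(2) by blast
    show ?thesis
    proof (rule make_diagonal_entries_nonradical[OF c z z' _ A(1) ij])
      fix B assume B: "B \<in> carrier S" "\<And>i. i < n \<Longrightarrow> B $$ (i, i) \<notin> jacobson_radical R"
      show "B \<in> torsion_units S <+>\<^bsub>S\<^esub> nilpotents S"
      proof (rule diagonal_sums_imp_sum[OF k B(1)])
        fix i assume "i < n"
        then have "B $$ (i, i) \<in> carrier R - jacobson_radical R"
          using B by simp
        then show "B $$ (i, i) \<in> torsion_units R <+>\<^bsub>R\<^esub> nilpotents R"
          by (simp only: R.sum_decomposition)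
      qed
    qed
  qed
  then show ?thesis
    using sub by unfold_locales blast
qed

end
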